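(* For $m\ge 2$ let $X_m$ be a random variable with the $\mathrm{PF\text{-}CME}_m$ density $f_m$, whose minimal ME order is $n_m=2r_m(m-1)+1$. Then, as $m\to\infty$, $$\operatorname{Var}(X_m)=\Theta\!\left(\frac{\log m}{m^2}\right)\quad\text{and}\quad \mathbb{E}[X_m]=1+O\!\left(\frac{\log m}{m^2}\right),$$ and consequently $$\mathrm{SCV}(X_m)=\Theta\!\left(\frac{\log m}{m^2}\right)=\Theta\!\left(\frac{\log^3 n_m}{n_m^2}\right).$$
   Context: $\log$ is the natural logarithm and $\log^3 n=(\log n)^3$. For an integer $m\ge2$, the Fejér kernel of order $m$ is $$\Phi_m(\theta)=1+2\sum_{\ell=1}^{m-1}\left(1-\frac{\ell}{m}\right)\cos(\ell\theta)=\frac1m\left(\frac{\sin(m\theta/2)}{\sin(\theta/2)}\right)^2,$$ the last expression being understood by continuity at multiples of $2\pi$. Set $$r_m:=\lceil\log m\rceil,\quad h_m:=2\log m+\log\log m,\quad \omega_m:=\frac{2\pi}{h_m},\quad W_m(\theta):=(\Phi_m(\theta))^{r_m}.$$ The powered-Fejér concentrated matrix-exponential density of index $m$ ($\mathrm{PF\text{-}CME}_m$) is $$f_m(t)=C_m\,e^{-t}\,W_m(\omega_m(t-1)),\qquad t\ge0,$$ where $C_m>0$ is the normalizing constant making $\int_0^\infty f_m(t)\,dt=1$. A probability density on $[0,\infty)$ is matrix-exponential (ME) if its Laplace transform is a rational function; its minimal ME order is the degree of the denominator of this rational function in lowest terms. The squared coefficient of variation is $\mathrm{SCV}(X)=\operatorname{Var}(X)/\mathbb{E}[X]^2$.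 Asymptotic notation, as $m\to\infty$: $f(m)=O(g(m))$ means $|f(m)|\le Cg(m)$ for all large $m$ for some $C>0$; $f(m)=\Theta(g(m))$ means $c\,g(m)\le f(m)\le C\,g(m)$ for all large $m$ for some constants $c,C>0$. *)

theory Defs
  imports "HOL-Probability.Probability" "HOL-Library.Landau_Symbols"
    "HOL-Computational_Algebra.Computational_Algebra"
begin

definition fejer :: "nat \<Rightarrow> real \<Rightarrow> real" where
  "fejer m \<theta> = 1 + 2 * (\<Sum>l=1..m-1. (1 - real l / real m) * cos (real l * \<theta>))"

definition pf_power :: "nat \<Rightarrow> nat" where
  "pf_power m = nat \<lceil>ln (real m)\<rceil>"

definition pf_period :: "nat \<Rightarrow> real" where
  "pf_period m = 2 * ln (real m) + ln (ln (real m))"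

definition pf_freq :: "nat \<Rightarrow> real" where
  "pf_freq m = 2 * pi / pf_period m"

definition powered_fejer :: "nat \<Rightarrow> real \<Rightarrow> real" where
  "powered_fejer m \<theta> = fejer m \<theta> ^ pf_power m"

definition pf_cme_const :: "nat \<Rightarrow> real" where
  "pf_cme_const m = 1 / (LBINT t:{0..}. exp (- t) * powered_fejer m (pf_freq m * (t - 1)))"

(* Densities on the half-line are functions on the whole real line vanishing for t < 0. *)
definition pf_cme :: "nat \<Rightarrow> real \<Rightarrow> real" where
  "pf_cme m t =
     (if t \<ge> 0 then pf_cme_const m * exp (- t) * powered_fejer m (pf_freq m * (t - 1)) else 0)"

definition prob_density_halfline :: "(real \<Rightarrow> real) \<Rightarrow> bool" where
  "prob_density_halfline f \<longleftrightarrow>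
     f \<in> borel_measurable borel \<and> (\<forall>t. f t \<ge> 0) \<and> (\<forall>t<0. f t = 0) \<and>
     (\<integral>\<^sup>+ t. ennreal (f t) \<partial>lborel) = 1"

definition laplace_transform :: "(real \<Rightarrow> real) \<Rightarrow> complex \<Rightarrow> complex" where
  "laplace_transform f s = (LBINT t:{0..}. exp (- (s * of_real t)) * of_real (f t))"

(* The Laplace transform of a probability density converges absolutely on the closed
   right half-plane, so this is where it is compared with the fraction. *)
definition rational_laplace :: "(real \<Rightarrow> real) \<Rightarrow> complex poly \<Rightarrow> complex poly \<Rightarrow> bool" where
  "rational_laplace f p q \<longleftrightarrow> coprime p q \<and>
     (\<forall>s. Re s \<ge> 0 \<longrightarrow> poly q s \<noteq> 0 \<and> laplace_transform f s = poly p s / poly q s)"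

definition matrix_exponential :: "(real \<Rightarrow> real) \<Rightarrow> bool" where
  "matrix_exponential f \<longleftrightarrow> prob_density_halfline f \<and> (\<exists>p q. rational_laplace f p q)"

(* Two fractions in lowest terms for the same transform differ by a unit, so the degree of the
   denominator is unique whenever f is matrix-exponential. *)
definition min_me_order :: "(real \<Rightarrow> real) \<Rightarrow> nat" where
  "min_me_order f = (THE n. \<exists>p q. rational_laplace f p q \<and> n = degree q)"

definition scv :: "'a measure \<Rightarrow> ('a \<Rightarrow> real) \<Rightarrow> real" where
  "scv M X = prob_space.variance M X / (prob_space.expectation M X)\<^sup>2"

end

theory Submission
  imports Defs "HOL-Real_Asymp.Real_Asymp"
begin

text \<open>
  Order: \<open>(z^(m-1) fejer m \<theta>)^r\<close> is, up to a constant, \<open>(1 + z + ... + z^(m-1))^(2r)\<close> at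
  \<open>z = cis \<theta>\<close>, so all its \<open>2r(m-1) + 1\<close> coefficients are positive. Each contributes one simple
  pole on the line \<open>Re s = -1\<close>, and nothing cancels.

  Moments: let \<open>V = (fejer m / m)^r\<close> in the variable \<open>t\<close>, with period \<open>h\<close>. Periodicity folds the
  integral over \<open>t > h\<close> back onto the half-line at the cost of \<open>exp (-h) = 1 / (m^2 log m)\<close>, so it
  contributes \<open>h^2 exp (-h)\<close>, of order \<open>log m / m^2\<close>, to the second moment about \<open>1\<close>. The peak at
  \<open>t = 1\<close> has width \<open>h / (m sqrt r)\<close>, which gives the same order; here one uses
  \<open>fejer m \<theta> \<le> m / (1 + (m \<theta>)^2 / 64)\<close>. The mean differs from \<open>1\<close> only by a second-moment term
  because \<open>V\<close> is symmetric about \<open>1\<close>. The lower bound on the variance holds because a density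
  bounded by \<open>B\<close> has variance at least \<open>1 / (32 B^2)\<close>.
\<close>

section \<open>The Fejer kernel\<close>

text \<open>Once the peak is scaled to height 1, the mass is only as large as the peak is wide, of
  order sqrt(ln m) / m, and the second moment has to be divided by it. With kappa = m / sqrt(32 ln
  m) the peak may therefore contribute kappa^(-3) to the second moment, but not kappa^(-2). A single
  Lorentzian 1 / (1 + y^2) in y = kappa (t - 1) decays too slowly for this; an r-th power with r at
  least 2 yields the decay 1 / (1 + y^4), which is enough. The folded tail avoids the loss, because
  its bound already carries the mass as a factor.

  One lower bound on the mass serves both directions of the variance estimate: from above it
  controls the division, from below it enters through the density bound B = 1 / mass.

  The link between kernel and geometric sum is proved in polynomial form, after multiplication by a
  power of \<open>cis \<theta>\<close>, so that multiples of 2 pi are no special case.\<close>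

lemma cis_add_cis_uminus: "cis a + cis (- a) = of_real (2 * cos a)"
  by (simp add: complex_eq_iff)

text \<open>Multiplication by \<open>cis \<theta> ^ m\<close> moves the frequencies -m, ..., m of
  the Dirichlet kernel to 0, ..., 2m, which leaves a plain geometric sum.\<close>

lemma dirichlet_kernel_cis:
  "of_real (1 + 2 * (\<Sum>l=1..m. cos (real l * \<theta>))) * cis \<theta> ^ m = (\<Sum>k\<le>2*m. cis \<theta> ^ k)"
proof (induction m)
  case (Suc m)
  let ?z = "cis \<theta>"
  have "of_real (2 * cos (real (Suc m) * \<theta>)) * ?z ^ Suc m
      = (cis (real (Suc m) * \<theta>) + cis (- (real (Suc m) * \<theta>))) * cis (real (Suc m) * \<theta>)"
    by (simp only: cis_add_cis_uminus Complex.DeMoivre)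
  also have "\<dots> = ?z ^ Suc m * ?z ^ Suc m + 1"
    by (simp only: Complex.DeMoivre ring_distribs cis_mult) simp
  also have "?z ^ Suc m * ?z ^ Suc m = ?z ^ (2 * Suc m)"
    by (simp only: power_add[symmetric] mult_2)
  finally have *: "of_real (2 * cos (real (Suc m) * \<theta>)) * ?z ^ Suc m = ?z ^ (2 * Suc m) + 1" .
  have "of_real (1 + 2 * (\<Sum>l=1..Suc m. cos (real l * \<theta>))) * ?z ^ Suc m
     = ?z * (of_real (1 + 2 * (\<Sum>l=1..m. cos (real l * \<theta>))) * ?z ^ m)
       + of_real (2 * cos (real (Suc m) * \<theta>)) * ?z ^ Suc m"
    by (simp add: algebra_simps)
  also have "\<dots> = ?z * (\<Sum>k\<le>2*m. ?z ^ k) + (?z ^ (2 * Suc m) + 1)"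
    by (simp only: Suc.IH *)
  also have "?z * (\<Sum>k\<le>2*m. ?z ^ k) = (\<Sum>k\<le>2*m. ?z ^ Suc k)"
    by (simp add: sum_distrib_left)
  also have "\<dots> + (?z ^ (2 * Suc m) + 1) = (\<Sum>k\<le>2*Suc m. ?z ^ k)"
    by (subst (2) sum.atMost_shift) (simp add: lessThan_Suc_atMost[symmetric])
  finally show ?case .
qed simp

lemma fejer_scaled:
  assumes "m > 0"
  shows "real m * fejer m \<theta> = real m + 2 * (\<Sum>l=1..m-1. (real m - real l) * cos (real l * \<theta>))"
proof -
  have "real m * (\<Sum>l=1..m-1. (1 - real l / real m) * cos (real l * \<theta>))
      = (\<Sum>l=1..m-1. (real m - real l) * cos (real l * \<theta>))"
    unfolding sum_distrib_left using assms by (intro sum.cong) (auto simp: field_simps)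
  thus ?thesis by (simp add: fejer_def algebra_simps)
qed

text \<open>The Fejer kernel as a Cesaro mean of Dirichlet kernels, in recursive form.\<close>

lemma fejer_scaled_Suc:
  assumes "m > 0"
  shows "real (Suc m) * fejer (Suc m) \<theta> = real m * fejer m \<theta> + (1 + 2 * (\<Sum>l=1..m. cos (real l * \<theta>)))"
proof -
  \<comment> \<open>The term \<open>l = m\<close> has weight \<open>real m - real l = 0\<close>, so
    the old sum may run over the new range.\<close>
  have "{1..m} = insert m {1..m-1}" using assms by auto
  hence "(\<Sum>l=1..m. (real m - real l) * cos (real l * \<theta>)) = (\<Sum>l=1..m-1. (real m - real l) * cos (real l * \<theta>))"
    using assms by simp
  moreover have "(\<Sum>l=1..m. (real (Suc m) - real l) * cos (real l * \<theta>))
     = (\<Sum>l=1..m. (real m - real l) * cos (real l * \<theta>)) + (\<Sum>l=1..m. cos (real l * \<theta>))"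
    by (simp add: sum.distrib[symmetric] algebra_simps)
  ultimately show ?thesis using assms
    unfolding fejer_scaled[OF assms] fejer_scaled[OF zero_less_Suc] by simp
qed

text \<open>Induction along the Cesaro recursion: the added Dirichlet kernel is exactly what is
  missing between z times the old square and the new square.\<close>

lemma fejer_cis_power:
  "of_real (real (Suc n) * fejer (Suc n) \<theta>) * cis \<theta> ^ n = (\<Sum>k\<le>n. cis \<theta> ^ k)\<^sup>2"
proof (induction n)
  case 0
  show ?case by (simp add: fejer_def)
next
  case (Suc n)
  let ?z = "cis \<theta>"
  let ?S = "\<Sum>k\<le>n. ?z ^ k"
  have 1: "(\<Sum>k\<le>Suc n. ?z ^ k) = ?S + ?z ^ Suc n" by simp
  have 2: "(\<Sum>k\<le>Suc n. ?z ^ k) = 1 + ?z * ?S"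
    by (subst sum.atMost_shift) (simp add: sum_distrib_left lessThan_Suc_atMost del: sum.lessThan_Suc)
  have 3: "(\<Sum>k\<le>2 * Suc n. ?z ^ k) = ?S + ?z ^ Suc n * (?S + ?z ^ Suc n)"
  proof -
    have "(\<Sum>k\<le>2 * Suc n. ?z ^ k) = (\<Sum>k<Suc n. ?z ^ k) + (\<Sum>k=Suc n..<Suc n + Suc (Suc n). ?z ^ k)"
      unfolding lessThan_Suc_atMost[symmetric] 
      by (subst lessThan_atLeast0, subst sum.atLeastLessThan_concat[symmetric, of 0 "Suc n"])
         (auto simp: lessThan_atLeast0 mult_2)
    also have "(\<Sum>k=Suc n..<Suc n + Suc (Suc n). ?z ^ k) = (\<Sum>k<Suc (Suc n). ?z ^ (Suc n + k))"
      using sum.shift_bounds_nat_ivl[of "\<lambda>k. ?z ^ k" 0 "Suc n" "Suc (Suc n)"]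
      by (simp add: lessThan_atLeast0 add.commute)
    also have "\<dots> = ?z ^ Suc n * (\<Sum>k<Suc (Suc n). ?z ^ k)"
      by (simp only: power_add sum_distrib_left)
    finally show ?thesis by (simp only: lessThan_Suc_atMost 1)
  qed
  have "of_real (real (Suc (Suc n)) * fejer (Suc (Suc n)) \<theta>) * ?z ^ Suc n
     = ?z * (of_real (real (Suc n) * fejer (Suc n) \<theta>) * ?z ^ n)
       + of_real (1 + 2 * (\<Sum>l=1..Suc n. cos (real l * \<theta>))) * ?z ^ Suc n"
    by (subst fejer_scaled_Suc) (simp_all add: algebra_simps del: sum.cl_ivl_Suc)
  also have "\<dots> = ?z * ?S\<^sup>2 + (\<Sum>k\<le>2 * Suc n. ?z ^ k)"
    by (simp only: Suc.IH dirichlet_kernel_cis)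
  also have "\<dots> = (?S + ?z ^ Suc n) * (1 + ?z * ?S)"
  proof -
    \<comment> \<open>The next geometric sum read in two ways: a new top power appended, or all
      powers shifted up and 1 prepended.\<close>
    have e: "1 + ?z * ?S = ?S + ?z ^ Suc n" using 1 2 by simp
    have "?z * ?S\<^sup>2 + (\<Sum>k\<le>2 * Suc n. ?z ^ k) = ?S * (1 + ?z * ?S) + ?z ^ Suc n * (?S + ?z ^ Suc n)"
      unfolding 3 by (simp add: algebra_simps power2_eq_square)
    also have "\<dots> = (?S + ?z ^ Suc n) * (?S + ?z ^ Suc n)"
      unfolding e by (simp add: algebra_simps)
    finally show ?thesis by (simp only: e)
  qed
  also have "\<dots> = (\<Sum>k\<le>Suc n. ?z ^ k)\<^sup>2"
    using 1 2 by (simp only: power2_eq_square)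
  finally show ?case .
qed

lemma fejer_eq_norm:
  assumes "m > 0"
  shows "fejer m \<theta> = (cmod (\<Sum>k<m. cis \<theta> ^ k))\<^sup>2 / real m"
proof -
  obtain n where m: "m = Suc n" using assms gr0_conv_Suc by auto
  let ?S = "\<Sum>k\<le>n. cis \<theta> ^ k"
  have S: "cnj (cis \<theta> ^ k) * cis \<theta> ^ n = cis \<theta> ^ (n - k)" if "k \<le> n" for k
    using that unfolding Complex.DeMoivre cis_cnj cis_mult by (simp add: of_nat_diff algebra_simps)
  have "of_real ((cmod ?S)\<^sup>2) * cis \<theta> ^ n = ?S * (cnj ?S * cis \<theta> ^ n)"
    by (simp only: complex_norm_square mult.assoc)
  \<comment> \<open>On the unit circle, conjugation followed by the factor z^n reverses the order of
    the powers 0, ..., n, and a sum with equal coefficients does not notice.\<close>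
  also have "cnj ?S * cis \<theta> ^ n = (\<Sum>k\<le>n. cis \<theta> ^ (n - k))"
    unfolding cnj_sum sum_distrib_right
    by (intro sum.cong refl S) simp
  also have "\<dots> = ?S"
    by (rule sum.nat_diff_reindex[where n = "Suc n", unfolded lessThan_Suc_atMost, simplified])
  finally have "of_real ((cmod ?S)\<^sup>2) * cis \<theta> ^ n = of_real (real (Suc n) * fejer (Suc n) \<theta>) * cis \<theta> ^ n"
    by (simp only: fejer_cis_power power2_eq_square)
  hence "of_real ((cmod ?S)\<^sup>2) = (of_real (real (Suc n) * fejer (Suc n) \<theta>) :: complex)"
    by simp
  hence "(cmod ?S)\<^sup>2 = real (Suc n) * fejer (Suc n) \<theta>"
    by (simp only: of_real_eq_iff)
  thus ?thesis by (simp add: m lessThan_Suc_atMost del: of_nat_Suc)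
qed

lemma fejer_nonneg: "m > 0 \<Longrightarrow> fejer m \<theta> \<ge> 0"
  by (simp add: fejer_eq_norm)

section \<open>Pointwise bounds on the kernel\<close>

lemma sum_triangle_weights:
  assumes "m > 0"
  shows "(\<Sum>l=1..m-1. 1 - real l / real m) = (real m - 1) / 2"
proof -
  have "(\<Sum>l=1..n. real l) = real n * (real n + 1) / 2" for n
    by (induction n) (simp_all add: field_simps)
  thus ?thesis using assms
    by (simp add: sum_subtractf sum_divide_distrib[symmetric] of_nat_diff)
qed

lemma sum_triangle_weights_squares:
  assumes "m > 0"
  shows "(\<Sum>l=1..m-1. (1 - real l / real m) * (real l)\<^sup>2) = real m * ((real m)\<^sup>2 - 1) / 12"
proof -
  have *: "(\<Sum>l=1..n. (a - real l) * (real l)\<^sup>2)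
      = a * (real n * (real n + 1) * (2 * real n + 1) / 6) - (real n * (real n + 1) / 2)\<^sup>2" for a n
    by (induction n) (simp_all add: field_simps power2_eq_square)
  have "(\<Sum>l=1..m-1. (1 - real l / real m) * (real l)\<^sup>2) = (\<Sum>l=1..m-1. (real m - real l) * (real l)\<^sup>2) / real m"
    unfolding sum_divide_distrib using assms by (intro sum.cong) (auto simp: field_simps)
  also have "\<dots> = real m * ((real m)\<^sup>2 - 1) / 12"
    unfolding * using assms by (simp add: of_nat_diff field_simps power2_eq_square)
  finally show ?thesis .
qed

text \<open>The deficit from the maximal value m has nonnegative weights, so bounds on
  \<open>1 - cos\<close> pass to the kernel in either direction.\<close>

lemma fejer_alt:
  assumes "m > 0"
  shows "fejer m \<theta> = real m - 2 * (\<Sum>l=1..m-1. (1 - real l / real m) * (1 - cos (real l * \<theta>)))"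
proof -
  have "(\<Sum>l=1..m-1. (1 - real l / real m) * (1 - cos (real l * \<theta>)))
      = (\<Sum>l=1..m-1. 1 - real l / real m) - (\<Sum>l=1..m-1. (1 - real l / real m) * cos (real l * \<theta>))"
    by (simp only: right_diff_distrib mult_1_right sum_subtractf)
  thus ?thesis
    unfolding fejer_def sum_triangle_weights[OF assms] by (simp add: field_simps)
qed

lemma fejer_le:
  assumes "m > 0"
  shows "fejer m \<theta> \<le> real m"
proof -
  have "(\<Sum>l=1..m-1. (1 - real l / real m) * (1 - cos (real l * \<theta>))) \<ge> 0"
    by (intro sum_nonneg mult_nonneg_nonneg) (auto simp: field_simps)
  thus ?thesis using fejer_alt[OF assms, of \<theta>] by simp
qed

lemma one_minus_cos_le: "1 - cos x \<le> x\<^sup>2 / (2::real)"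
proof -
  have "1 - cos x = 2 * (sin (x/2))\<^sup>2"
    using cos_double_sin[of "x/2"] by simp
  also have "\<dots> \<le> 2 * (x/2)\<^sup>2"
    using abs_sin_x_le_abs_x[of "x/2"] by (simp only: abs_le_square_iff)
  finally show ?thesis by (simp add: power2_eq_square)
qed

lemma fejer_ge:
  assumes "m > 0"
  shows "fejer m \<theta> \<ge> real m * (1 - (real m * \<theta>)\<^sup>2)"
proof -
  have "(\<Sum>l=1..m-1. (1 - real l / real m) * (1 - cos (real l * \<theta>)))
      \<le> (\<Sum>l=1..m-1. (1 - real l / real m) * ((real l * \<theta>)\<^sup>2 / 2))"
    by (intro sum_mono mult_left_mono one_minus_cos_le) (auto simp: field_simps)
  also have "\<dots> = \<theta>\<^sup>2 / 2 * (\<Sum>l=1..m-1. (1 - real l / real m) * (real l)\<^sup>2)"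
    unfolding sum_distrib_left by (intro sum.cong) (auto simp: power_mult_distrib)
  also have "\<dots> = \<theta>\<^sup>2 / 2 * (real m * ((real m)\<^sup>2 - 1) / 12)"
    by (simp only: sum_triangle_weights_squares[OF assms])
  \<comment> \<open>The factor 1/12 is given away; only the scale \<open>real m * \<theta>\<close>
    matters for the width of the peak.\<close>
  also have "\<dots> \<le> \<theta>\<^sup>2 / 2 * (real m * (real m)\<^sup>2)"
    by (intro mult_left_mono) (auto simp: field_simps)
  finally show ?thesis
    using fejer_alt[OF assms, of \<theta>] by (simp add: power_mult_distrib algebra_simps)
qed

text \<open>Concavity of the sine. The endpoint is left free: \<open>a = pi / 2\<close> gives
  Jordan's inequality, \<open>a = pi / 6\<close> a steeper chord for small angles.\<close>

lemma sin_ge_chord: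
  assumes "0 \<le> x" "x \<le> a" "0 < a" "a \<le> pi"
  shows "sin x \<ge> x / a * sin (a::real)"
proof -
  have "convex_on {0..pi} (\<lambda>x. - sin x :: real)"
    by (rule f''_ge0_imp_convex[where f' = "\<lambda>x. - cos x" and f'' = sin])
       (auto intro!: derivative_eq_intros sin_ge_zero)
  from convex_onD[OF this, of "x / a" 0 a] assms show ?thesis
    by simp
qed

lemma one_minus_cos_ge:
  assumes "\<bar>y\<bar> \<le> pi"
  shows "1 - cos y \<ge> 2 * (y / pi)\<^sup>2"
proof -
  have "sin (\<bar>y\<bar> / 2) \<ge> \<bar>y\<bar> / 2 / (pi / 2) * sin (pi / 2)"
    using assms by (intro sin_ge_chord) auto
  hence "(\<bar>y\<bar> / pi)\<^sup>2 \<le> (sin (\<bar>y\<bar> / 2))\<^sup>2"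
    by (intro power_mono) auto
  moreover have "1 - cos \<bar>y\<bar> = 2 * (sin (\<bar>y\<bar>/2))\<^sup>2"
    using cos_double_sin[of "\<bar>y\<bar>/2"] by simp
  ultimately show ?thesis by (simp add: power_divide)
qed

text \<open>The condition on \<open>\<theta>\<close> keeps every \<open>real l * \<theta>\<close>
  inside [-pi, pi], where each cosine obeys the quadratic bound.\<close>

lemma fejer_le_near:
  assumes "m \<ge> 2" "real m * \<bar>\<theta>\<bar> \<le> pi"
  shows "fejer m \<theta> \<le> real m * (1 - (real m * \<theta>)\<^sup>2 / 64)"
proof -
  have m: "m > 0" using assms by simp
  have "(\<Sum>l=1..m-1. (1 - real l / real m) * (1 - cos (real l * \<theta>)))
      \<ge> (\<Sum>l=1..m-1. (1 - real l / real m) * (2 * (real l * \<theta> / pi)\<^sup>2))"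
  proof (intro sum_mono mult_left_mono one_minus_cos_ge)
    fix l assume l: "l \<in> {1..m-1}"
    have "\<bar>real l * \<theta>\<bar> \<le> real m * \<bar>\<theta>\<bar>"
      using l by (auto simp: abs_mult intro!: mult_right_mono)
    thus "\<bar>real l * \<theta>\<bar> \<le> pi" using assms by simp
    show "0 \<le> 1 - real l / real m" using l by (auto simp: field_simps)
  qed
  moreover have "(\<Sum>l=1..m-1. (1 - real l / real m) * (2 * (real l * \<theta> / pi)\<^sup>2))
      = 2 * (\<theta> / pi)\<^sup>2 * (\<Sum>l=1..m-1. (1 - real l / real m) * (real l)\<^sup>2)"
    unfolding sum_distrib_left by (intro sum.cong) (auto simp: power_mult_distrib power_divide)
  ultimately have *: "fejer m \<theta> \<le> real m - real m * ((\<theta> / pi)\<^sup>2 * (((real m)\<^sup>2 - 1) / 3))"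
    unfolding sum_triangle_weights_squares[OF m] fejer_alt[OF m] by simp
  \<comment> \<open>For m at least 2, (m^2 - 1) / 3 is at least m^2 / 4. With pi < 4 this leads to
    the constant 64 = 4 * 4^2.\<close>
  have "2\<^sup>2 \<le> (real m)\<^sup>2" using assms by (intro power_mono) auto
  hence "(\<theta> / pi)\<^sup>2 * (((real m)\<^sup>2 - 1) / 3) \<ge> (\<theta> / pi)\<^sup>2 * ((real m)\<^sup>2 / 4)"
    by (intro mult_left_mono) auto
  moreover have "pi\<^sup>2 \<le> 4\<^sup>2"
    by (intro power_mono) (use pi_less_4 in auto)
  hence "4 * pi\<^sup>2 \<le> 64" by simp
  hence "(real m * \<theta>)\<^sup>2 / 64 \<le> (real m * \<theta>)\<^sup>2 / (4 * pi\<^sup>2)"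
    by (intro divide_left_mono) auto
  moreover have "(\<theta> / pi)\<^sup>2 * ((real m)\<^sup>2 / 4) = (real m * \<theta>)\<^sup>2 / (4 * pi\<^sup>2)"
    by (simp add: power_mult_distrib power_divide mult_ac)
  ultimately have "(real m * \<theta>)\<^sup>2 / 64 \<le> (\<theta> / pi)\<^sup>2 * (((real m)\<^sup>2 - 1) / 3)"
    by linarith
  hence "real m * ((real m * \<theta>)\<^sup>2 / 64) \<le> real m * ((\<theta> / pi)\<^sup>2 * (((real m)\<^sup>2 - 1) / 3))"
    by (intro mult_left_mono) auto
  with * show ?thesis by (simp only: right_diff_distrib mult_1_right)
qed

text \<open>The geometric sum telescopes against \<open>cis \<theta> - 1\<close>, whose modulus is
  \<open>2 * \<bar>sin (\<theta> / 2)\<bar>\<close>, and \<open>cis \<theta> ^ m - 1\<close> has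
  modulus at most 2.\<close>

lemma fejer_le_sin:
  assumes "m > 0" "sin (\<theta> / 2) \<noteq> 0"
  shows "fejer m \<theta> \<le> 1 / (real m * (sin (\<theta> / 2))\<^sup>2)"
proof -
  let ?S = "\<Sum>k<m. cis \<theta> ^ k"
  have "?S * (cis \<theta> - 1) = cis \<theta> ^ m - 1"
    using power_diff_1_eq[of "cis \<theta>" m] by (simp add: mult.commute)
  hence "cmod ?S * cmod (cis \<theta> - 1) = cmod (cis \<theta> ^ m - 1)"
    by (metis norm_mult)
  also have "\<dots> \<le> 2"
    using norm_triangle_ineq4[of "cis \<theta> ^ m" 1] by (simp add: norm_power)
  finally have "cmod ?S * (2 * \<bar>sin (\<theta> / 2)\<bar>) \<le> 2"
    using dist_exp_i_1[of \<theta>] by (simp add: cis_conv_exp)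
  hence "cmod ?S * \<bar>sin (\<theta> / 2)\<bar> \<le> 1" by simp
  hence "(cmod ?S * \<bar>sin (\<theta> / 2)\<bar>)\<^sup>2 \<le> 1"
    by (intro power_le_one) auto
  thus ?thesis using assms
    by (simp add: fejer_eq_norm power_mult_distrib field_simps)
qed

text \<open>Joins the parabolic cap and the decay beyond it in one Lorentzian. This shape is
  convenient for r-th powers, since (1 + x)^r can be expanded.\<close>

lemma fejer_le_inverse_square:
  assumes "m \<ge> 2" "\<bar>\<theta>\<bar> \<le> 1"
  shows "fejer m \<theta> \<le> real m / (1 + (real m * \<theta>)\<^sup>2 / 64)"
proof (cases "real m * \<bar>\<theta>\<bar> \<le> pi")
  case True
  let ?y = "(real m * \<theta>)\<^sup>2 / 64"
  have "(1 - ?y) * (1 + ?y) \<le> 1"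
    by (simp add: algebra_simps)
  hence "1 - ?y \<le> 1 / (1 + ?y)"
    by (subst pos_le_divide_eq) (auto intro: add_pos_nonneg)
  hence "real m * (1 - ?y) \<le> real m * (1 / (1 + ?y))"
    by (intro mult_left_mono) auto
  with fejer_le_near[OF assms(1) True] show ?thesis by simp
next
  case False
  let ?y = "(real m * \<theta>)\<^sup>2"
  have "\<theta> \<noteq> 0" using False by auto
  \<comment> \<open>The steep chord is essential: Jordan's inequality would only give the factor
    pi^2 / y with y = (m theta)^2, which exceeds 1 / (1 + y / 64) near y = pi^2.\<close>
  have "sin (\<bar>\<theta>\<bar> / 2) \<ge> \<bar>\<theta>\<bar> / 2 / (pi / 6) * sin (pi / 6)"
    using assms pi_gt3 by (intro sin_ge_chord) auto
  also have "\<bar>\<theta>\<bar> / 2 / (pi / 6) * sin (pi / 6) = 3 * \<bar>\<theta>\<bar> / (2 * pi)"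
    by (simp add: sin_30)
  finally have s: "3 * \<bar>\<theta>\<bar> / (2 * pi) \<le> sin (\<bar>\<theta>\<bar> / 2)" .
  have "(3 * \<bar>\<theta>\<bar> / (2 * pi))\<^sup>2 \<le> (sin (\<bar>\<theta>\<bar> / 2))\<^sup>2"
    using s by (intro power_mono) auto
  also have "\<dots> = (sin (\<theta> / 2))\<^sup>2"
    by (cases "\<theta> \<ge> 0") auto
  finally have s2: "9 * \<theta>\<^sup>2 / (4 * pi\<^sup>2) \<le> (sin (\<theta> / 2))\<^sup>2"
    by (simp add: power_divide power_mult_distrib)
  have pos: "0 < 9 * \<theta>\<^sup>2 / (4 * pi\<^sup>2)" using \<open>\<theta> \<noteq> 0\<close> by simp
  have "sin (\<theta> / 2) \<noteq> 0" using s2 pos by auto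
  hence "fejer m \<theta> \<le> 1 / (real m * (sin (\<theta> / 2))\<^sup>2)"
    using assms by (intro fejer_le_sin) auto
  also have "\<dots> \<le> 1 / (real m * (9 * \<theta>\<^sup>2 / (4 * pi\<^sup>2)))"
    using s2 pos assms by (intro divide_left_mono mult_left_mono mult_pos_pos) auto
  also have "\<dots> = real m * ((4 / 9 * pi\<^sup>2) / ?y)"
    using assms \<open>\<theta> \<noteq> 0\<close> by (simp add: field_simps power2_eq_square)
  also have "\<dots> \<le> real m * (1 / (1 + ?y / 64))"
  proof (intro mult_left_mono)
    \<comment> \<open>With y at least pi^2 and pi^2 at most 16, the quantity 4/9 pi^2 (1 + y / 64)
      is at most 4/9 y + 1/9 y.\<close>
    have "pi\<^sup>2 \<le> ?y"
      using False power_mono[of pi "real m * \<bar>\<theta>\<bar>" 2] by (simp add: power_mult_distrib)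
    moreover have "pi\<^sup>2 \<le> 4\<^sup>2"
      by (intro power_mono) (use pi_less_4 in auto)
    hence "4 / 9 * pi\<^sup>2 * ?y \<le> 4 / 9 * 16 * ?y"
      by (intro mult_right_mono mult_left_mono) auto
    hence "4 / 9 * pi\<^sup>2 * ?y / 64 \<le> ?y / 9" by simp
    moreover have "4 / 9 * pi\<^sup>2 * (1 + ?y / 64) = 4 / 9 * pi\<^sup>2 + 4 / 9 * pi\<^sup>2 * ?y / 64"
      by (simp only: distrib_left mult_1_right times_divide_eq_right)
    ultimately have "4 / 9 * pi\<^sup>2 * (1 + ?y / 64) \<le> ?y"
      using zero_le_power2[of pi] by linarith
    moreover have "?y > 0" using assms \<open>\<theta> \<noteq> 0\<close> by simp
    ultimately show "(4 / 9 * pi\<^sup>2) / ?y \<le> 1 / (1 + ?y / 64)"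
      by (simp add: field_simps add_pos_pos)
  qed simp
  finally show ?thesis by simp
qed

lemma fejer_le_off_peak:
  assumes "m > 0" "0 < a" "a \<le> \<theta>" "\<theta> \<le> 2 * pi - a"
  shows "fejer m \<theta> \<le> real m * (pi / (real m * a))\<^sup>2"
proof -
  \<comment> \<open>Half the distance to the nearer of the peaks 0 and 2 pi; it lies in [0, pi / 2],
    where Jordan's inequality applies.\<close>
  define x where "x = min \<theta> (2 * pi - \<theta>) / 2"
  have x: "a / 2 \<le> x" "x \<le> pi / 2" using assms by (auto simp: x_def min_def)
  have "sin (\<theta> / 2) = sin x"
    using sin_pi_minus[of "\<theta> / 2"] by (auto simp: x_def min_def diff_divide_distrib)
  moreover have "sin x \<ge> x / (pi / 2) * sin (pi / 2)"
    using x assms by (intro sin_ge_chord) auto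
  moreover have "x / (pi / 2) \<ge> a / pi"
    using x by (simp add: field_simps)
  ultimately have s: "a / pi \<le> sin (\<theta> / 2)" by simp
  have pos: "0 < a / pi" using assms by simp
  hence sin_pos: "0 < sin (\<theta> / 2)" using s by linarith
  hence "fejer m \<theta> \<le> 1 / (real m * (sin (\<theta> / 2))\<^sup>2)"
    using assms by (intro fejer_le_sin) auto
  also have "\<dots> \<le> 1 / (real m * (a / pi)\<^sup>2)"
    using s pos assms sin_pos by (intro divide_left_mono mult_left_mono mult_pos_pos power_mono) auto
  also have "\<dots> = real m * (pi / (real m * a))\<^sup>2"
    using assms by (simp add: field_simps power2_eq_square)
  finally show ?thesis .
qed

lemma fejer_periodic: "fejer m (\<theta> + 2 * pi) = fejer m \<theta>"
proof -
  have "cos (real l * (\<theta> + 2 * pi)) = cos (real l * \<theta>)" for l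
    using cos_int_2pin[of "int l"] sin_int_2pin[of "int l"] by (simp add: ring_distribs cos_add mult_ac)
  thus ?thesis by (simp only: fejer_def)
qed

lemma fejer_minus: "fejer m (- \<theta>) = fejer m \<theta>"
  by (simp add: fejer_def)

lemma continuous_on_fejer [continuous_intros]:
  fixes f :: "real \<Rightarrow> real"
  shows "continuous_on A f \<Longrightarrow> continuous_on A (\<lambda>x. fejer m (f x))"
  unfolding fejer_def by (intro continuous_intros continuous_on_cos)

section \<open>Exponential sums and the minimal order\<close>

text \<open>Strict positivity is the point: every exponential occurs, hence every pole. Convolution
  with the all-ones sequence creates no zero inside the support. The vanishing beyond
  \<open>N * n\<close> is carried along for the Cauchy product.\<close>

lemma geometric_sum_power_pos_coeffs:
  "\<exists>c::nat \<Rightarrow> real. (\<forall>j\<le>N*n. c j > 0) \<and> (\<forall>j>N*n. c j = 0) \<and>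
     (\<forall>z::complex. (\<Sum>k\<le>n. z ^ k) ^ N = (\<Sum>j\<le>N*n. of_real (c j) * z ^ j))"
proof (induction N)
  case 0
  show ?case by (intro exI[of _ "\<lambda>j. if j = 0 then 1 else 0"]) auto
next
  case (Suc N)
  then obtain c :: "nat \<Rightarrow> real" where c: "\<And>j. j \<le> N*n \<Longrightarrow> c j > 0" "\<And>j. j > N*n \<Longrightarrow> c j = 0"
    "\<And>z::complex. (\<Sum>k\<le>n. z ^ k) ^ N = (\<Sum>j\<le>N*n. of_real (c j) * z ^ j)"
    by blast
  define u :: "nat \<Rightarrow> real" where "u k = (if k \<le> n then 1 else 0)" for k
  define d where "d j = (\<Sum>k\<le>j. u k * c (j - k))" for j
  have c_nonneg: "c j \<ge> 0" for j using c(1,2)[of j] by (cases "j \<le> N*n") auto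
  show ?case
  proof (intro exI[of _ d] conjI allI impI)
    fix j assume j: "j \<le> Suc N * n"
    \<comment> \<open>The summand \<open>k = min n j\<close> lies in both supports:
      \<open>k \<le> n\<close> and \<open>j - k \<le> N * n\<close>.\<close>
    have "0 < u (min n j) * c (j - min n j)"
      using j by (auto simp: u_def min_def intro!: c(1))
    also have "\<dots> \<le> d j"
      unfolding d_def using c_nonneg by (intro member_le_sum) (auto simp: u_def)
    finally show "d j > 0" .
  next
    fix j assume j: "j > Suc N * n"
    show "d j = 0"
      unfolding d_def
    proof (intro sum.neutral ballI)
      fix k assume "k \<in> {..j}"
      thus "u k * c (j - k) = 0"
        using j by (cases "k \<le> n") (auto simp: u_def intro!: c(2))
    qed
  next
    fix z :: complex
    have "(\<Sum>k\<le>n. z ^ k) = (\<Sum>k\<le>n. of_real (u k) * z ^ k)"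
      by (intro sum.cong) (auto simp: u_def)
    hence "(\<Sum>k\<le>n. z ^ k) ^ Suc N = (\<Sum>k\<le>n. of_real (u k) * z ^ k) * (\<Sum>j\<le>N*n. of_real (c j) * z ^ j)"
      by (subst power_Suc, subst c(3)) (simp only:)
    also have "\<dots> = (\<Sum>j\<le>n + N*n. (\<Sum>k\<le>j. of_real (u k) * of_real (c (j - k))) * z ^ j)"
      by (rule polynomial_product) (auto simp: u_def c(2))
    also have "\<dots> = (\<Sum>j\<le>Suc N*n. of_real (d j) * z ^ j)"
      by (simp add: d_def)
    finally show "(\<Sum>k\<le>n. z ^ k) ^ Suc N = (\<Sum>j\<le>Suc N*n. of_real (d j) * z ^ j)" .
  qed
qed

text \<open>The powers 0, ..., 2K become the frequencies -K, ..., K with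
  \<open>K = r * (m - 1)\<close>; the unshifted index \<open>j\<close> keeps the sum over natural
  numbers.\<close>

lemma fejer_power_cis_expansion:
  assumes "m > 0"
  shows "\<exists>c::nat \<Rightarrow> real. (\<forall>j\<le>2*(r*(m-1)). c j > 0) \<and>
     (\<forall>\<theta>. of_real (fejer m \<theta> ^ r) =
        (\<Sum>j\<le>2*(r*(m-1)). of_real (c j) * cis ((real j - real (r*(m-1))) * \<theta>)))"
proof -
  obtain n where m: "m = Suc n" using assms gr0_conv_Suc by auto
  let ?K = "r * n"
  obtain c :: "nat \<Rightarrow> real" where c: "\<And>j. j \<le> 2 * ?K \<Longrightarrow> c j > 0"
    "\<And>z::complex. (\<Sum>k\<le>n. z ^ k) ^ (2 * r) = (\<Sum>j\<le>2 * ?K. of_real (c j) * z ^ j)"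
    using geometric_sum_power_pos_coeffs[where N = "2 * r" and n = n]
    by (metis mult.assoc)
  have "of_real (fejer m \<theta> ^ r) =
        (\<Sum>j\<le>2*?K. of_real (c j / real m ^ r) * cis ((real j - real ?K) * \<theta>))" for \<theta>
  proof -
    have "of_real (real m ^ r * fejer m \<theta> ^ r) * cis \<theta> ^ ?K = ((\<Sum>k\<le>n. cis \<theta> ^ k)\<^sup>2) ^ r"
      unfolding fejer_cis_power[symmetric] m
      by (simp add: power_mult_distrib power_mult[symmetric] mult.commute del: of_nat_Suc)
    also have "\<dots> = (\<Sum>j\<le>2 * ?K. of_real (c j) * cis \<theta> ^ j)"
      by (simp add: c(2) power_mult[symmetric])
    also have "\<dots> = (\<Sum>j\<le>2 * ?K. of_real (c j) * cis ((real j - real ?K) * \<theta>)) * cis \<theta> ^ ?K"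
      unfolding sum_distrib_right
      by (intro sum.cong refl) (simp add: Complex.DeMoivre cis_mult algebra_simps)
    finally have "of_real (real m ^ r) * of_real (fejer m \<theta> ^ r) =
        (\<Sum>j\<le>2 * ?K. of_real (c j) * cis ((real j - real ?K) * \<theta>))"
      by simp
    hence "of_real (fejer m \<theta> ^ r) =
        (\<Sum>j\<le>2 * ?K. of_real (c j) * cis ((real j - real ?K) * \<theta>)) / of_real (real m ^ r)"
      using assms by (simp add: field_simps)
    thus ?thesis by (simp add: sum_divide_distrib)
  qed
  thus ?thesis using c(1) assms by (intro exI[of _ "\<lambda>j. c j / real m ^ r"]) (simp add: m)
qed

section \<open>Laplace transforms of complex exponentials\<close>

lemma set_integrable_exp_halfline:
  fixes w :: complex
  assumes "Re w > 0"
  shows "set_integrable lborel {0<..} (\<lambda>t. exp (- (w * of_real t)))"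
proof (rule set_integrable_bound)
  show "set_integrable lborel {0<..} (\<lambda>t. exp (- (t * Re w)))"
    using assms by (rule integrable_I0i_exp_mscale)
  show "set_borel_measurable lborel {0<..} (\<lambda>t. exp (- (w * of_real t)))"
    unfolding set_borel_measurable_def by measurable
qed (auto simp: mult.commute)

lemma set_integral_exp_halfline:
  fixes w :: complex
  assumes "Re w > 0"
  shows "set_integrable lborel {0..} (\<lambda>t. exp (- (w * of_real t)))"
    and "(LBINT t:{0..}. exp (- (w * of_real t))) = 1 / w"
proof -
  let ?f = "\<lambda>t. exp (- (w * of_real t))"
  have w: "w \<noteq> 0" using assms by auto
  note int = set_integrable_exp_halfline[OF assms]
  have "(LBINT t=0..\<infinity>. ?f t) = 0 - (- (1 / w))"
  proof (rule interval_integral_FTC_integrable)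
    let ?F = "\<lambda>t::real. - (?f t / w)"
    show "(?F has_vector_derivative ?f x) (at x)" for x
      by (rule has_vector_derivative_real_field) (use w in \<open>auto intro!: derivative_eq_intros\<close>)
    show "isCont ?f x" for x by (intro continuous_intros)
    show "set_integrable lborel (einterval 0 \<infinity>) ?f"
      using int by (simp add: einterval_def zero_ereal_def greaterThan_def)
    have "(?F \<longlongrightarrow> ?F 0) (at_right 0)"
      by (intro tendsto_intros) (use w in auto)
    thus "((?F \<circ> real_of_ereal) \<longlongrightarrow> - (1 / w)) (at_right 0)"
      by (simp add: ereal_tendsto_simps zero_ereal_def)
    \<comment> \<open>The imaginary part of \<open>w\<close> only contributes a factor of modulus
      one, so the limit at infinity is settled by norms.\<close>
    have "((\<lambda>t. exp (- (a * t))) \<longlongrightarrow> 0) at_top" if "a > 0" for a :: real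
      using that by real_asymp
    hence "((\<lambda>t. exp (- (Re w * t)) / cmod w) \<longlongrightarrow> 0) at_top"
      using assms by (intro tendsto_divide_zero)
    hence "(?F \<longlongrightarrow> 0) at_top"
      by (subst tendsto_norm_zero_iff[symmetric]) (simp add: norm_divide)
    thus "((?F \<circ> real_of_ereal) \<longlongrightarrow> 0) (at_left \<infinity>)"
      by (simp add: ereal_tendsto_simps)
  qed auto
  hence "(LBINT t:{0<..}. ?f t) = 1 / w"
    by (simp add: interval_lebesgue_integral_0_infty)
  \<comment> \<open>The fundamental theorem of calculus was applied on the open half-line; the
    endpoint is a null set.\<close>
  moreover have "(LBINT t:{0..}. ?f t) = (LBINT t:{0<..}. ?f t)"
    by (rule set_integral_cong_set)
       (auto simp: set_borel_measurable_def intro!: AE_I'[of "{0::real}"])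
  ultimately show "(LBINT t:{0..}. ?f t) = 1 / w" by simp
  have "{0..} = {0} \<union> {0::real<..}" by auto
  moreover have "set_integrable lborel {0} ?f"
  proof -
    have "integrable lborel (\<lambda>t. indicat_real {0} t *\<^sub>R ?f 0)"
      by (intro integrable_scaleR_left) auto
    also have "(\<lambda>t. indicat_real {0} t *\<^sub>R ?f 0) = (\<lambda>t. indicat_real {0} t *\<^sub>R ?f t)"
      by (auto simp: fun_eq_iff indicator_def)
    finally show ?thesis unfolding set_integrable_def .
  qed
  ultimately show "set_integrable lborel {0..} ?f"
    using set_integrable_Un[OF _ int, of "{0}"] by simp
qed

section \<open>Rational transforms in lowest terms\<close>

lemma complex_poly_root:
  fixes p :: "complex poly"
  assumes "degree p > 0"
  obtains s where "poly p s = 0"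
  using fundamental_theorem_of_algebra[of p] assms by (auto simp: constant_degree)

lemma coprime_complex_polyI:
  fixes p q :: "complex poly"
  assumes no_root: "\<And>s. poly q s = 0 \<Longrightarrow> poly p s \<noteq> 0" and "q \<noteq> 0"
  shows "coprime p q"
proof (rule coprimeI)
  fix c assume c: "c dvd p" "c dvd q"
  hence "c \<noteq> 0" using \<open>q \<noteq> 0\<close> by auto
  have "degree c = 0"
  proof (rule ccontr)
    assume "degree c \<noteq> 0"
    then obtain s where "poly c s = 0" using complex_poly_root by blast
    hence "poly p s = 0" "poly q s = 0" using c by (auto elim!: dvdE)
    with no_root show False by blast
  qed
  with \<open>c \<noteq> 0\<close> show "is_unit c" by (simp add: is_unit_iff_degree)
qed

lemma coprime_complex_polyD:
  fixes p q :: "complex poly"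
  assumes "coprime p q" "poly q s = 0"
  shows "poly p s \<noteq> 0"
proof
  assume "poly p s = 0"
  with assms have "is_unit [:- s, 1:]"
    by (auto simp: poly_eq_0_iff_dvd dest: coprime_common_divisor)
  thus False by (simp add: is_unit_iff_degree)
qed

text \<open>The library has Euclid's lemma only in GCD domains, and \<^typ>\<open>complex\<close> is not an instance of
  the corresponding class.\<close>
lemma complex_poly_dvd_cancel:
  fixes p q q' :: "complex poly"
  assumes "\<And>s. poly q s = 0 \<Longrightarrow> poly p s \<noteq> 0" "q \<noteq> 0" "q dvd p * q'"
  shows "q dvd q'"
  using assms
proof (induction "degree q" arbitrary: q q')
  case 0
  hence "is_unit q" by (simp add: is_unit_iff_degree)
  thus ?case by (rule unit_imp_dvd)
next
  case (Suc n)
  have "degree q > 0" using Suc.hyps(2) by linarith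
  then obtain s where s: "poly q s = 0" by (rule complex_poly_root)
  then obtain q1 where q1: "q = [:- s, 1:] * q1" by (auto simp: poly_eq_0_iff_dvd elim: dvdE)
  obtain k where "p * q' = q * k" using Suc.prems(3) by (elim dvdE)
  hence "poly (p * q') s = 0" using s by (simp only: poly_mult mult_zero_left)
  hence "poly q' s = 0" using Suc.prems(1)[OF s] by (simp only: poly_mult mult_eq_0_iff simp_thms)
  then obtain q2 where q2: "q' = [:- s, 1:] * q2" by (auto simp: poly_eq_0_iff_dvd elim: dvdE)
  have "q1 \<noteq> 0" using Suc.prems(2) unfolding q1 by (metis mult_zero_right)
  have "degree q = degree [:- s, 1:] + degree q1"
    unfolding q1 using \<open>q1 \<noteq> 0\<close> by (intro degree_mult_eq) auto
  hence "n = degree q1" using Suc.hyps(2) by simp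
  moreover have "poly p u \<noteq> 0" if "poly q1 u = 0" for u
    using Suc.prems(1)[of u] that unfolding q1 by (simp only: poly_mult mult_zero_right simp_thms)
  moreover have "[:- s, 1:] * q1 dvd [:- s, 1:] * (p * q2)"
    using Suc.prems(3) unfolding q1 q2 mult.left_commute[of p] .
  hence "q1 dvd p * q2"
    by (rule iffD1[OF dvd_times_left_cancel_iff, rotated]) simp
  ultimately have "q1 dvd q2" using \<open>q1 \<noteq> 0\<close> Suc.hyps(1) by blast
  thus ?case unfolding q1 q2 by (rule mult_dvd_mono[OF dvd_refl])
qed

text \<open>Partial fractions: each exponential contributes \<open>a i / (s - z i)\<close>. Distinct
  exponents make the poles simple and nonzero coefficients keep every residue alive, so nothing
  cancels over the common denominator.\<close>

lemma rational_laplace_exp_sum: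
  assumes fin: "finite I" and inj: "inj_on z I"
    and z: "\<And>i. i \<in> I \<Longrightarrow> Re (z i) < 0" and a: "\<And>i. i \<in> I \<Longrightarrow> a i \<noteq> 0"
    and f: "\<And>t. t \<ge> 0 \<Longrightarrow> of_real (f t) = (\<Sum>i\<in>I. a i * exp (z i * of_real t))"
  shows "\<exists>p q. rational_laplace f p q \<and> degree q = card I"
proof -
  define q where "q = (\<Prod>i\<in>I. [:- z i, 1:])"
  define p where "p = (\<Sum>i\<in>I. smult (a i) (\<Prod>j\<in>I-{i}. [:- z j, 1:]))"
  have pole: "s - z i \<noteq> 0" if "Re s \<ge> 0" "i \<in> I" for s i
    using z[OF that(2)] that(1) by auto
  have q: "poly q s = (\<Prod>i\<in>I. s - z i)" for s
    by (simp add: q_def poly_prod)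
  have p: "poly p s = (\<Sum>i\<in>I. a i * (\<Prod>j\<in>I-{i}. s - z j))" for s
    by (simp add: p_def poly_sum poly_prod)
  have lap: "laplace_transform f s = poly p s / poly q s" if s: "Re s \<ge> 0" for s
  proof -
    have int: "set_integrable lborel {0..} (\<lambda>t. exp (- ((s - z i) * of_real t)))"
      "(LBINT t:{0..}. exp (- ((s - z i) * of_real t))) = 1 / (s - z i)" if "i \<in> I" for i
      using set_integral_exp_halfline[of "s - z i"] z[OF that] s by auto
    have "laplace_transform f s = (LBINT t:{0..}. (\<Sum>i\<in>I. a i * exp (- ((s - z i) * of_real t))))"
      unfolding laplace_transform_def
    proof (rule set_lebesgue_integral_cong, safe)
      fix t :: real assume "0 \<le> t"
      thus "exp (- (s * of_real t)) * of_real (f t) = (\<Sum>i\<in>I. a i * exp (- ((s - z i) * of_real t)))"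
        by (simp add: f sum_distrib_left exp_add[symmetric] mult.left_commute algebra_simps)
    qed auto
    also have "\<dots> = (\<Sum>i\<in>I. LBINT t:{0..}. a i * exp (- ((s - z i) * of_real t)))"
      unfolding set_lebesgue_integral_def scaleR_sum_right
      by (intro Bochner_Integration.integral_sum)
         (use int(1) in \<open>auto simp: set_integrable_def[symmetric]\<close>)
    also have "\<dots> = (\<Sum>i\<in>I. a i / (s - z i))"
      by (intro sum.cong refl) (simp add: int)
    also have "\<dots> = poly p s / poly q s"
      unfolding p q sum_divide_distrib
    proof (intro sum.cong refl)
      fix i assume i: "i \<in> I"
      show "a i / (s - z i) = a i * (\<Prod>j\<in>I-{i}. s - z j) / (\<Prod>i\<in>I. s - z i)"
        using pole[OF s] fin i by (subst prod.remove[OF fin i]) (auto simp: field_simps)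
    qed
    finally show ?thesis .
  qed
  have "coprime p q"
  proof (rule coprime_complex_polyI)
    fix s assume "poly q s = 0"
    then obtain i where i: "i \<in> I" "s = z i" using fin by (auto simp: q)
    \<comment> \<open>Every term of the numerator but the i-th keeps the factor vanishing at
      \<open>z i\<close>. What survives is \<open>a i\<close> times the derivative of
      \<open>q\<close> at \<open>z i\<close>, nonzero because the root is simple.\<close>
    have "(\<Prod>j\<in>I-{k}. z i - z j) = 0" if "k \<in> I - {i}" for k
      using that i fin by (intro prod_zero) (auto intro!: bexI[of _ i])
    hence "(\<Sum>k\<in>I-{i}. a k * (\<Prod>j\<in>I-{k}. z i - z j)) = 0"
      by (intro sum.neutral ballI) simp
    hence "poly p s = a i * (\<Prod>j\<in>I-{i}. z i - z j)"
      unfolding p i by (simp add: sum.remove[OF fin i(1)])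
    thus "poly p s \<noteq> 0"
      using a[OF i(1)] fin i inj by (auto simp: inj_on_def)
  next
    have "\<forall>i\<in>I. [:- z i, 1:] \<noteq> 0" by simp
    thus "q \<noteq> 0" using fin by (simp add: q_def)
  qed
  moreover have "poly q s \<noteq> 0" if "Re s \<ge> 0" for s
    using pole[OF that] fin by (simp add: q)
  moreover have "degree q = card I"
    unfolding q_def by (subst degree_prod_eq_sum_degree) auto
  ultimately show ?thesis using lap unfolding rational_laplace_def by blast
qed

text \<open>The closed right half-plane contains all natural numbers, so the cross-multiplied
  polynomials agree at infinitely many points and hence identically. Coprimality then gives
  divisibility of the denominators in both directions.\<close>

lemma rational_laplace_degree_unique:
  assumes "rational_laplace f p q" "rational_laplace f p' q'"
  shows "degree q = degree q'"
proof -
  have eq: "poly (p * q' - p' * q) s = 0" if "Re s \<ge> 0" for s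
  proof -
    have "poly p s / poly q s = poly p' s / poly q' s" "poly q s \<noteq> 0" "poly q' s \<noteq> 0"
      using assms that unfolding rational_laplace_def by metis+
    thus ?thesis by (simp add: field_simps)
  qed
  have "infinite (range (of_nat :: nat \<Rightarrow> complex))"
    by (intro range_inj_infinite inj_of_nat)
  moreover have "range of_nat \<subseteq> {s. poly (p * q' - p' * q) s = 0}"
    using eq by auto
  ultimately have "infinite {s. poly (p * q' - p' * q) s = 0}"
    using finite_subset by blast
  hence "p * q' - p' * q = 0" using poly_roots_finite by blast
  hence e: "p * q' = p' * q" by simp
  have cop: "coprime p q" "coprime p' q'" and "q \<noteq> 0" "q' \<noteq> 0"
    using assms unfolding rational_laplace_def by (auto dest: spec[of _ 0])
  have "q dvd q'"
    using coprime_complex_polyD[OF cop(1)] \<open>q \<noteq> 0\<close>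
    by (rule complex_poly_dvd_cancel) (simp_all add: e)
  moreover have "q' dvd q"
    using coprime_complex_polyD[OF cop(2)] \<open>q' \<noteq> 0\<close>
    by (rule complex_poly_dvd_cancel) (simp_all flip: e)
  ultimately show ?thesis using \<open>q \<noteq> 0\<close> \<open>q' \<noteq> 0\<close> by (intro antisym dvd_imp_degree_le)
qed

lemma min_me_order_eq_degree:
  assumes "rational_laplace f p q"
  shows "min_me_order f = degree q"
  unfolding min_me_order_def
  using assms rational_laplace_degree_unique by (intro the_equality) blast+

section \<open>Exponentially damped periodic weights\<close>

lemma abs_exp_minus_one_le: "\<bar>exp x - 1\<bar> \<le> \<bar>x\<bar> * exp \<bar>x :: real\<bar>"
proof (cases "x \<ge> 0")
  case True
  have "1 - x \<le> exp (- x)" using exp_ge_add_one_self[of "-x"] by simp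
  hence "(1 - x) * exp x \<le> exp (- x) * exp x" by (intro mult_right_mono) auto
  hence "exp x - 1 \<le> x * exp x" by (simp add: algebra_simps exp_add[symmetric])
  thus ?thesis using True by simp
next
  case False
  have "\<bar>exp x - 1\<bar> \<le> \<bar>x\<bar>"
    using exp_ge_add_one_self[of x] exp_le_one_iff[of x] False by linarith
  also have "\<dots> \<le> \<bar>x\<bar> * exp \<bar>x\<bar>" by (simp add: mult_le_cancel_left1)
  finally show ?thesis .
qed

section \<open>Integrability and elementary integrals\<close>

text \<open>One envelope for the weights 1, t - 1 and (t - 1)^2, each at most (1 + t)^2 in modulus
  on the half-line.\<close>

lemma set_integrable_exp_poly_bound:
  fixes g :: "real \<Rightarrow> real"
  assumes [measurable]: "g \<in> borel_measurable borel"
    and g: "\<And>t. t \<ge> 0 \<Longrightarrow> \<bar>g t\<bar> \<le> C * (1 + t)\<^sup>2 * exp (- t)"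
  shows "set_integrable lborel {0..} g"
proof -
  have k: "set_integrable lborel {0..} (\<lambda>t. t ^ k * exp (- t) :: real)" for k
    using has_bochner_integral_I0i_power_exp_m'[of k]
    unfolding set_integrable_def by (simp add: integrable.intros mult_ac)
  have "set_integrable lborel {0..} (\<lambda>t. C * (t ^ 0 * exp (- t) + (2 * (t ^ 1 * exp (- t)) + t\<^sup>2 * exp (- t))))"
    by (intro set_integrable_mult_right set_integral_add(1) k)
  also have "(\<lambda>t. C * (t ^ 0 * exp (- t) + (2 * (t ^ 1 * exp (- t)) + t\<^sup>2 * exp (- t))))
      = (\<lambda>t::real. C * (1 + t)\<^sup>2 * exp (- t))"
    by (simp add: fun_eq_iff algebra_simps power2_eq_square)
  finally have "set_integrable lborel {0..} (\<lambda>t::real. C * (1 + t)\<^sup>2 * exp (- t))" .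
  thus ?thesis
    by (rule set_integrable_bound)
       (auto simp: set_borel_measurable_def abs_mult intro!: order.trans[OF g])
qed

lemma integrable_indicator_Icc: "integrable lborel (indicat_real {a..b::real})"
  by (rule integrable_real_indicator) (auto simp: emeasure_lborel_Icc_eq)

text \<open>An interval of length 2 delta carries mass at most 2 delta B, which is 1/2 for delta = 1
  / (4 B). So half of the mass has distance at least delta from \<open>\<mu>\<close>, whatever
  \<open>\<mu>\<close> is, and contributes delta^2 / 2.\<close>

lemma second_moment_ge_of_bounded_density:
  fixes f :: "real \<Rightarrow> real"
  assumes nonneg: "\<And>t. f t \<ge> 0" and bound: "\<And>t. f t \<le> B" and B: "B > 0"
    and int: "integrable lborel f" and mass: "(LBINT t. f t) = 1"
    and int2: "integrable lborel (\<lambda>t. f t * (t - \<mu>)\<^sup>2)"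
  shows "(LBINT t. f t * (t - \<mu>)\<^sup>2) \<ge> 1 / (32 * B\<^sup>2)"
proof -
  define \<delta> where "\<delta> = 1 / (4 * B)"
  have \<delta>: "\<delta> > 0" using B by (simp add: \<delta>_def)
  let ?J = "{\<mu>-\<delta>..\<mu>+\<delta>}"
  have J: "integrable lborel (indicat_real ?J)" by (rule integrable_indicator_Icc)
  have "1 / (32 * B\<^sup>2) = \<delta>\<^sup>2 * (1 - B * (2 * \<delta>))"
    using B by (simp add: \<delta>_def power2_eq_square field_simps)
  also have "B * (2 * \<delta>) = (LBINT t. B * indicator ?J t)"
    using \<delta> by simp
  also have "\<delta>\<^sup>2 * (1 - \<dots>) = (LBINT t. \<delta>\<^sup>2 * (f t - B * indicator ?J t))"
    using int mass J by (subst integral_mult_right_zero, subst Bochner_Integration.integral_diff) auto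
  also have "\<dots> \<le> (LBINT t. f t * (t - \<mu>)\<^sup>2)"
  proof (rule integral_mono)
    show "integrable lborel (\<lambda>t. \<delta>\<^sup>2 * (f t - B * indicator ?J t))"
      using int J by auto
    fix t
    show "\<delta>\<^sup>2 * (f t - B * indicator ?J t) \<le> f t * (t - \<mu>)\<^sup>2"
    proof (cases "t \<in> ?J")
      case True
      hence "\<delta>\<^sup>2 * (f t - B * indicator ?J t) \<le> 0"
        using bound[of t] by (auto simp: mult_le_0_iff)
      also have "\<dots> \<le> f t * (t - \<mu>)\<^sup>2" using nonneg by simp
      finally show ?thesis .
    next
      case False
      hence "\<delta>\<^sup>2 \<le> (t - \<mu>)\<^sup>2"
        using \<delta> by (subst abs_le_square_iff[symmetric]) auto
      hence "f t * \<delta>\<^sup>2 \<le> f t * (t - \<mu>)\<^sup>2"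
        using nonneg by (intro mult_left_mono)
      thus ?thesis using False by (simp add: mult.commute)
    qed
  qed (rule int2)
  finally show ?thesis .
qed

text \<open>The integrand majorizes \<open>(t - 1)\<^sup>2 / (1 + (\<kappa> * (t - 1)) ^ 4)\<close>
  and has a much simpler antiderivative.\<close>

lemma integral_arctan_kernel:
  assumes \<kappa>: "\<kappa> > 0" and "a \<le> b"
  shows "(LBINT t:{a..b}. 2 / \<kappa>\<^sup>2 * (1 / (1 + (\<kappa> * (t - 1))\<^sup>2)))
       = 2 / \<kappa> ^ 3 * arctan (\<kappa> * (b - 1)) - 2 / \<kappa> ^ 3 * arctan (\<kappa> * (a - 1))"
proof -
  define k where "k t = 2 / \<kappa>\<^sup>2 * (1 / (1 + (\<kappa> * (t - 1))\<^sup>2))" for t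
  have pos: "0 < 1 + (\<kappa> * (x - 1))\<^sup>2" for x
    by (auto intro!: add_pos_nonneg)
  have "(LBINT t. k t * indicator {a..b} t)
      = 2 / \<kappa> ^ 3 * arctan (\<kappa> * (b - 1)) - 2 / \<kappa> ^ 3 * arctan (\<kappa> * (a - 1))"
  proof (rule integral_FTC_Icc_real)
    fix x :: real
    have "((\<lambda>t. 2 / \<kappa> ^ 3 * arctan (\<kappa> * (t - 1))) has_real_derivative
        2 / \<kappa> ^ 3 * (inverse (1 + (\<kappa> * (x - 1))\<^sup>2) * \<kappa>)) (at x)"
      by (intro DERIV_cmult) (auto intro!: derivative_eq_intros)
    also have "2 / \<kappa> ^ 3 * (inverse (1 + (\<kappa> * (x - 1))\<^sup>2) * \<kappa>) = k x"
      using \<kappa> unfolding k_def by (simp add: power3_eq_cube power2_eq_square inverse_eq_divide)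
    finally show "((\<lambda>t. 2 / \<kappa> ^ 3 * arctan (\<kappa> * (t - 1))) has_real_derivative k x) (at x)" .
    have "1 + (\<kappa> * (x - 1))\<^sup>2 \<noteq> 0" using pos[of x] by simp
    thus "isCont k x"
      unfolding k_def[abs_def] by (intro continuous_intros)
  qed (use assms in auto)
  thus ?thesis
    unfolding set_lebesgue_integral_def k_def by (simp add: mult.commute)
qed

section \<open>Moments of a periodic weight\<close>

text \<open>Isolates what the moment estimates use of the kernel. The intended \<open>V\<close> is
  the powered kernel divided by its maximal value, as a function of time, so the symmetry is
  evenness about the peak \<open>t = 1\<close>.\<close>

locale periodic_weight =
  fixes V :: "real \<Rightarrow> real" and h :: real
  assumes V_cont: "continuous_on UNIV V"
    and V_nonneg: "V t \<ge> 0" and V_le_1: "V t \<le> 1"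
    and V_periodic: "V (t + h) = V t"
    and V_symmetric: "V (2 - t) = V t"
begin

lemma V_measurable [measurable]: "V \<in> borel_measurable borel"
  using V_cont by (rule borel_measurable_continuous_onI)

definition mass :: real where "mass = (LBINT t:{0..}. exp (- t) * V t)"
definition moment1 :: real where "moment1 = (LBINT t:{0..}. (t - 1) * (exp (- t) * V t))"
definition moment2 :: real where "moment2 = (LBINT t:{0..}. (t - 1)\<^sup>2 * (exp (- t) * V t))"

lemma weighted_integrable:
  assumes [measurable]: "g \<in> borel_measurable borel"
    and g: "\<And>t. t \<ge> 0 \<Longrightarrow> \<bar>g t\<bar> \<le> C * (1 + t)\<^sup>2"
  shows "set_integrable lborel {0..} (\<lambda>t. g t * (exp (- t) * V t))"
proof (rule set_integrable_exp_poly_bound)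
  fix t :: real assume "t \<ge> 0"
  have "exp (- t) * V t \<le> exp (- t)"
    using V_le_1[of t] by (simp add: mult_le_cancel_left2)
  hence "\<bar>g t\<bar> * (exp (- t) * V t) \<le> (C * (1 + t)\<^sup>2) * exp (- t)"
    using g[OF \<open>t \<ge> 0\<close>] V_nonneg[of t] by (intro mult_mono) auto
  thus "\<bar>g t * (exp (- t) * V t)\<bar> \<le> C * (1 + t)\<^sup>2 * exp (- t)"
    using V_nonneg[of t] by (simp add: abs_mult)
qed simp

lemma mass_integrable: "set_integrable lborel {0..} (\<lambda>t. exp (- t) * V t)"
proof -
  have "\<bar>1\<bar> \<le> 1 * (1 + t)\<^sup>2" if "t \<ge> 0" for t :: real
    using that power_mono[of 1 "1 + t" 2] by simp
  thus ?thesis using weighted_integrable[of "\<lambda>_. 1" 1] by simp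
qed

lemma moment1_integrable: "set_integrable lborel {0..} (\<lambda>t. (t - 1) * (exp (- t) * V t))"
proof (rule weighted_integrable)
  show "\<bar>t - 1\<bar> \<le> 1 * (1 + t)\<^sup>2" if "t \<ge> 0" for t :: real
    using that zero_le_power2[of t] by (simp add: power2_sum abs_le_iff)
qed simp

lemma moment2_integrable: "set_integrable lborel {0..} (\<lambda>t. (t - 1)\<^sup>2 * (exp (- t) * V t))"
proof (rule weighted_integrable)
  show "\<bar>(t - 1)\<^sup>2\<bar> \<le> 1 * (1 + t)\<^sup>2" if "t \<ge> 0" for t :: real
    using that by (simp add: power2_sum power2_diff abs_le_iff)
qed simp

lemma mass_nonneg: "mass \<ge> 0"
  unfolding mass_def set_lebesgue_integral_def
  by (intro integral_nonneg_AE) (auto simp: V_nonneg)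

lemma moment2_nonneg: "moment2 \<ge> 0"
  unfolding moment2_def set_lebesgue_integral_def
  by (intro integral_nonneg_AE) (auto simp: V_nonneg)

lemma mass_ge:
  assumes \<delta>: "0 \<le> \<delta>" "\<delta> \<le> 1" and V: "\<And>t. 1 \<le> t \<Longrightarrow> t \<le> 1 + \<delta> \<Longrightarrow> V t \<ge> 1 / 2"
  shows "mass \<ge> exp (- 2) * \<delta> / 2"
proof -
  have "exp (- 2) * \<delta> / 2 = (LBINT t. (exp (- 2) / 2) * indicator {1..1+\<delta>} t)"
    using \<delta> by simp
  also have "\<dots> \<le> (LBINT t. indicator {0..} t *\<^sub>R (exp (- t) * V t))"
  proof (rule integral_mono)
    show "integrable lborel (\<lambda>t. (exp (- 2) / 2) * indicat_real {1..1+\<delta>} t)"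
      by (intro integrable_mult_right integrable_indicator_Icc)
    show "integrable lborel (\<lambda>t. indicator {0..} t *\<^sub>R (exp (- t) * V t))"
      using mass_integrable unfolding set_integrable_def .
    fix t
    \<comment> \<open>Here \<open>t \<le> 2\<close> because \<open>\<delta> \<le> 1\<close>, whence
      the constant \<open>exp (- 2)\<close>.\<close>
    have "exp (- 2) * (1 / 2) \<le> exp (- t) * V t" if "1 \<le> t" "t \<le> 1 + \<delta>"
      using that \<delta> V[OF that] by (intro mult_mono) auto
    thus "(exp (- 2) / 2) * indicator {1..1+\<delta>} t \<le> indicator {0..} t *\<^sub>R (exp (- t) * V t)"
      by (auto simp: indicator_def V_nonneg)
  qed
  finally show ?thesis by (simp add: mass_def set_lebesgue_integral_def)
qed

text \<open>Since \<^term>\<open>V\<close> is symmetric about \<open>1\<close>, the factor \<^term>\<open>exp (- t)\<close> may be replaced by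
  \<^term>\<open>exp (- t) - exp (- 1)\<close> on \<open>[0, 2]\<close>, which gains a factor \<^term>\<open>\<bar>t - 1\<bar>\<close>.\<close>
lemma moment1_bound: "\<bar>moment1\<bar> \<le> exp 1 * moment2"
proof -
  define g where "g t = indicat_real {0..2} t * ((t - 1) * V t)" for t
  have g_int: "integrable lborel g"
  proof -
    have "integrable lborel (\<lambda>t. indicat_real {0..2} t *\<^sub>R ((t - 1) * V t))"
      by (intro borel_integrable_compact continuous_intros continuous_on_subset[OF V_cont]) auto
    thus ?thesis by (simp add: g_def[abs_def])
  qed
  \<comment> \<open>The reflection of t to 2 - t maps [0, 2] to itself and flips the sign of
    \<open>t - 1\<close>.\<close>
  have "(LBINT t. g t) = (LBINT t. g (2 + (-1) * t))"
    using lborel_integral_real_affine[of "-1" g 2] by simp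
  also have "\<dots> = (LBINT t. - g t)"
    using V_symmetric by (intro Bochner_Integration.integral_cong) (auto simp: g_def indicator_def algebra_simps)
  finally have g0: "(LBINT t. g t) = 0" by simp
  let ?f = "\<lambda>t. indicat_real {0..} t *\<^sub>R ((t - 1) * (exp (- t) * V t))"
  have f_int: "integrable lborel ?f"
    using moment1_integrable unfolding set_integrable_def .
  have eq: "moment1 = (LBINT t. ?f t - exp (- 1) * g t)"
    using f_int g_int g0
    by (subst Bochner_Integration.integral_diff) (simp_all add: moment1_def set_lebesgue_integral_def)
  have "\<bar>moment1\<bar> \<le> (LBINT t. \<bar>?f t - exp (- 1) * g t\<bar>)"
    unfolding eq by (rule integral_abs_bound)
  also have "\<dots> \<le> (LBINT t. exp 1 * (indicat_real {0..} t *\<^sub>R ((t - 1)\<^sup>2 * (exp (- t) * V t))))"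
  proof (rule integral_mono)
    show "integrable lborel (\<lambda>t. \<bar>?f t - exp (- 1) * g t\<bar>)"
      by (intro integrable_abs Bochner_Integration.integrable_diff integrable_mult_right f_int g_int)
    show "integrable lborel (\<lambda>t. exp 1 * (indicat_real {0..} t *\<^sub>R ((t - 1)\<^sup>2 * (exp (- t) * V t))))"
      using moment2_integrable unfolding set_integrable_def by (intro integrable_mult_right)
    fix t :: real
    consider "t < 0" | "0 \<le> t" "t \<le> 2" | "t > 2" by linarith
    thus "\<bar>?f t - exp (- 1) * g t\<bar> \<le> exp 1 * (indicat_real {0..} t *\<^sub>R ((t - 1)\<^sup>2 * (exp (- t) * V t)))"
    proof cases
      case 2
      have "?f t - exp (- 1) * g t = (t - 1) * exp (- t) * V t * (1 - exp (t - 1))"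
        using 2 by (simp add: g_def algebra_simps exp_add[symmetric])
      also have "\<bar>\<dots>\<bar> = \<bar>t - 1\<bar> * exp (- t) * V t * \<bar>exp (t - 1) - 1\<bar>"
        using V_nonneg[of t] by (simp add: abs_mult abs_minus_commute[of 1])
      also have "\<dots> \<le> \<bar>t - 1\<bar> * exp (- t) * V t * (\<bar>t - 1\<bar> * exp 1)"
      proof (intro mult_left_mono)
        have "\<bar>exp (t - 1) - 1\<bar> \<le> \<bar>t - 1\<bar> * exp \<bar>t - 1\<bar>"
          by (rule abs_exp_minus_one_le)
        also have "\<dots> \<le> \<bar>t - 1\<bar> * exp 1"
          using 2 by (intro mult_left_mono) auto
        finally show "\<bar>exp (t - 1) - 1\<bar> \<le> \<bar>t - 1\<bar> * exp 1" .
      qed (auto simp: V_nonneg)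
      also have "\<dots> = exp 1 * ((\<bar>t - 1\<bar> * \<bar>t - 1\<bar>) * (exp (- t) * V t))"
        by (simp add: mult_ac)
      finally show ?thesis using 2 by (simp add: power2_eq_square)
    next
      case 3
      \<comment> \<open>Beyond 2 a point has no mirror image on the half-line, but there
        \<open>t - 1 > 1\<close>, so the square dominates.\<close>
      have "(t - 1) * (exp (- t) * V t) \<le> (exp 1 * (t - 1)\<^sup>2) * (exp (- t) * V t)"
      proof (intro mult_right_mono)
        have "1 * (t - 1) \<le> exp 1 * ((t - 1) * (t - 1))"
          using 3 by (intro mult_mono) (auto simp: mult_le_cancel_left1)
        thus "t - 1 \<le> exp 1 * (t - 1)\<^sup>2" by (simp add: power2_eq_square)
      qed (auto simp: V_nonneg)
      thus ?thesis using 3 by (simp add: g_def V_nonneg abs_mult mult_ac)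
    qed (simp add: g_def)
  qed
  finally show ?thesis by (simp add: moment2_def set_lebesgue_integral_def)
qed

text \<open>The folded tail contains \<open>moment2\<close> again, with coefficient
  \<open>2 * exp (- h)\<close>. The assumption makes this at most 1/2, so the term is absorbed on
  the left, at the price of doubling the rest.\<close>

lemma moment2_le_period:
  assumes h: "h \<ge> 0" "exp (- h) \<le> 1 / 4"
  shows "moment2 \<le> 2 * (LBINT t:{0..h}. (t - 1)\<^sup>2 * (exp (- t) * V t)) + 4 * h\<^sup>2 * exp (- h) * mass"
proof -
  let ?w = "\<lambda>t. (t - 1)\<^sup>2 * (exp (- t) * V t)"
  let ?S0 = "LBINT t:{0..h}. ?w t"
  have int0: "set_integrable lborel {0..h} ?w"
    by (rule set_integrable_subset[OF moment2_integrable]) auto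
  have int1: "set_integrable lborel {h<..} ?w"
    by (rule set_integrable_subset[OF moment2_integrable]) (use h in auto)
  have "{0..} = {0..h} \<union> {h<..}" using h by auto
  moreover have "{0..h} \<inter> {h<..} = {}" by auto
  ultimately have split: "moment2 = ?S0 + (LBINT t:{h<..}. ?w t)"
    unfolding moment2_def using set_integral_Un[OF _ int0 int1] by simp
  have "(LBINT t:{h<..}. ?w t) = (LBINT t. indicat_real {h<..} (h + 1 * t) *\<^sub>R ?w (h + 1 * t))"
    unfolding set_lebesgue_integral_def by (subst lborel_integral_real_affine[of 1 _ h]) simp_all
  also have "\<dots> \<le> (LBINT t. exp (- h) * (2 * (indicat_real {0..} t *\<^sub>R ?w t)
                         + 2 * h\<^sup>2 * (indicat_real {0..} t *\<^sub>R (exp (- t) * V t))))"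
  proof (rule integral_mono)
    show "integrable lborel (\<lambda>t. indicat_real {h<..} (h + 1 * t) *\<^sub>R ?w (h + 1 * t))"
      using int1 lborel_integrable_real_affine_iff[of 1 "\<lambda>t. indicat_real {h<..} t *\<^sub>R ?w t" h]
      unfolding set_integrable_def by simp
    show "integrable lborel (\<lambda>t. exp (- h) * (2 * (indicat_real {0..} t *\<^sub>R ?w t)
                         + 2 * h\<^sup>2 * (indicat_real {0..} t *\<^sub>R (exp (- t) * V t))))"
      using moment2_integrable mass_integrable unfolding set_integrable_def
      by (intro integrable_mult_right Bochner_Integration.integrable_add)
    fix t :: real
    have "?w (h + t) = (h + (t - 1))\<^sup>2 * (exp (- h) * (exp (- t) * V t))"
      using V_periodic[of t] by (simp add: exp_diff exp_minus field_simps)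
    also have "\<dots> \<le> (2 * (t - 1)\<^sup>2 + 2 * h\<^sup>2) * (exp (- h) * (exp (- t) * V t))"
    proof (rule mult_right_mono)
      show "(h + (t - 1))\<^sup>2 \<le> 2 * (t - 1)\<^sup>2 + 2 * h\<^sup>2"
        using zero_le_power2[of "h - (t - 1)"] by (simp add: power2_sum power2_diff)
    qed (simp add: V_nonneg)
    finally have "?w (h + t) \<le> exp (- h) * (2 * ?w t + 2 * h\<^sup>2 * (exp (- t) * V t))"
      by (simp add: algebra_simps)
    thus "indicat_real {h<..} (h + 1 * t) *\<^sub>R ?w (h + 1 * t) \<le> exp (- h) * (2 * (indicat_real {0..} t *\<^sub>R ?w t)
                         + 2 * h\<^sup>2 * (indicat_real {0..} t *\<^sub>R (exp (- t) * V t)))"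
      using V_nonneg[of t] h by (cases "t > 0"; cases "t \<ge> 0") (simp_all add: indicator_def)
  qed
  also have "\<dots> = exp (- h) * (2 * moment2 + 2 * h\<^sup>2 * mass)"
  proof -
    have "(LBINT t. exp (- h) * (2 * p t + 2 * h\<^sup>2 * q t))
        = exp (- h) * (2 * (LBINT t. p t) + 2 * h\<^sup>2 * (LBINT t. q t))"
      if "integrable lborel p" "integrable lborel q" for p q :: "real \<Rightarrow> real"
      using that by (simp only: integral_mult_right_zero Bochner_Integration.integral_add integrable_mult_right)
    from this[OF moment2_integrable[unfolded set_integrable_def] mass_integrable[unfolded set_integrable_def]]
    show ?thesis unfolding moment2_def mass_def set_lebesgue_integral_def .
  qed
  also have "\<dots> \<le> moment2 / 2 + 2 * h\<^sup>2 * exp (- h) * mass"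
    using mult_right_mono[OF h(2) moment2_nonneg] by (simp add: algebra_simps)
  finally have "(LBINT t:{h<..}. ?w t) \<le> moment2 / 2 + 2 * h\<^sup>2 * exp (- h) * mass" .
  thus ?thesis using split by linarith
qed

text \<open>Quartic decay makes (t - 1)^2 \<open>V t\<close> integrable on the scale of the peak,
  uniformly in \<open>\<kappa>\<close>: height 1 / kappa^2 times width 1 / kappa. Off the peak a
  crude bound suffices, (t - 1)^2 at most h^2 over a length at most h.\<close>

lemma central_period_bound:
  assumes \<kappa>: "\<kappa> > 0" and h: "h \<ge> 2"
    and near: "\<And>t. 0 \<le> t \<Longrightarrow> t \<le> 2 \<Longrightarrow> V t \<le> 1 / (1 + (\<kappa> * (t - 1)) ^ 4)"
    and far: "\<And>t. 2 \<le> t \<Longrightarrow> t \<le> h \<Longrightarrow> V t \<le> \<epsilon>"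
  shows "(LBINT t:{0..h}. (t - 1)\<^sup>2 * (exp (- t) * V t)) \<le> 2 * pi / \<kappa> ^ 3 + h ^ 3 * \<epsilon>"
proof -
  let ?w = "\<lambda>t. (t - 1)\<^sup>2 * (exp (- t) * V t)"
  let ?k = "\<lambda>t. 2 / \<kappa>\<^sup>2 * (1 / (1 + (\<kappa> * (t - 1))\<^sup>2))"
  have \<epsilon>: "\<epsilon> \<ge> 0" using far[of 2] V_nonneg[of 2] h by auto
  have int: "set_integrable lborel A ?w" if "A \<subseteq> {0..}" "A \<in> sets borel" for A
    using set_integrable_subset[OF moment2_integrable, of A] that by simp
  have w_le: "?w t \<le> (t - 1)\<^sup>2 * V t" if "t \<ge> 0" for t
    using that V_nonneg[of t] by (intro mult_left_mono) (auto simp: mult_le_cancel_right2)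
  have "{0..h} = {0..2} \<union> {2<..h}" using h by auto
  moreover have "{0..2} \<inter> {2<..h} = {}" by auto
  ultimately have split: "(LBINT t:{0..h}. ?w t) = (LBINT t:{0..2}. ?w t) + (LBINT t:{2<..h}. ?w t)"
    using set_integral_Un[of "{0..2}" "{2<..h}" lborel ?w] int[of "{0..2}"] int[of "{2<..h}"]
    by (simp add: subset_eq)
  have near1: "(LBINT t:{0..2}. ?w t) \<le> (LBINT t:{0..2}. ?k t)"
  proof (rule set_integral_mono)
    have "1 + (\<kappa> * (t - 1))\<^sup>2 \<noteq> 0" for t
      using zero_le_power2[of "\<kappa> * (t - 1)"] by linarith
    thus "set_integrable lborel {0..2} ?k"
      unfolding set_integrable_def
      by (intro borel_integrable_compact continuous_intros) auto
    fix t :: real assume t: "t \<in> {0..2}"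
    let ?y = "\<kappa> * (t - 1)"
    have "?w t \<le> (t - 1)\<^sup>2 * (1 / (1 + ?y ^ 4))"
      using w_le[of t] mult_left_mono[OF near[of t], of "(t - 1)\<^sup>2"] t by auto
    also have "\<dots> = 1 / \<kappa>\<^sup>2 * (?y\<^sup>2 / (1 + ?y ^ 4))"
      using \<kappa> by (simp add: power_mult_distrib)
    also have "\<dots> \<le> 1 / \<kappa>\<^sup>2 * (2 / (1 + ?y\<^sup>2))"
    proof (rule mult_left_mono)
      have "y\<^sup>2 * (1 + y\<^sup>2) \<le> 2 * (1 + y ^ 4)" for y :: real
      proof -
        \<comment> \<open>The difference is y^4 - y^2 + 2, displayed as a sum of squares.\<close>
        have "2 * (1 + y ^ 4) - y\<^sup>2 * (1 + y\<^sup>2) = ((y\<^sup>2 - 1)\<^sup>2 + (y\<^sup>2)\<^sup>2 + 3) / 2"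
          by (simp add: power4_eq_xxxx power2_eq_square field_simps)
        also have "\<dots> \<ge> 0" by simp
        finally show ?thesis by simp
      qed
      from this[of ?y] have "?y\<^sup>2 * (1 + ?y\<^sup>2) \<le> 2 * (1 + ?y ^ 4)" .
      moreover have "0 < 1 + ?y\<^sup>2" "0 < 1 + ?y ^ 4"
        by (auto intro!: add_pos_nonneg)
      ultimately show "?y\<^sup>2 / (1 + ?y ^ 4) \<le> 2 / (1 + ?y\<^sup>2)"
        by (simp add: divide_le_eq le_divide_eq mult.commute)
    qed (use \<kappa> in auto)
    finally show "?w t \<le> ?k t" by simp
  qed (rule int; auto)
  have near2: "(LBINT t:{0..2}. ?k t) = 2 / \<kappa> ^ 3 * arctan (\<kappa> * (2 - 1)) - 2 / \<kappa> ^ 3 * arctan (\<kappa> * (0 - 1))"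
    using integral_arctan_kernel[OF \<kappa>, of 0 2] by simp
  have near3: "2 / \<kappa> ^ 3 * arctan (\<kappa> * (2 - 1)) - 2 / \<kappa> ^ 3 * arctan (\<kappa> * (0 - 1)) \<le> 2 / \<kappa> ^ 3 * pi"
    using arctan_ubound[of \<kappa>] \<kappa> by (auto simp: arctan_minus field_simps)
  have far1: "(LBINT t:{2<..h}. ?w t) \<le> (LBINT t:{2<..h}. h\<^sup>2 * \<epsilon>)"
  proof (rule set_integral_mono)
    have "integrable lborel (indicat_real {2<..h})"
      by (rule integrable_real_indicator) (use h in \<open>auto simp: emeasure_lborel_Ioc\<close>)
    thus "set_integrable lborel {2<..h} (\<lambda>t. h\<^sup>2 * \<epsilon>)"
      unfolding set_integrable_def by (rule integrable_scaleR_left)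
    fix t assume t: "t \<in> {2<..h}"
    have "(t - 1)\<^sup>2 \<le> h\<^sup>2" using t by (intro power_mono) auto
    hence "(t - 1)\<^sup>2 * V t \<le> h\<^sup>2 * \<epsilon>"
      using t far[of t] V_nonneg by (intro mult_mono) auto
    thus "?w t \<le> h\<^sup>2 * \<epsilon>"
      using order.trans[OF w_le[of t], of "h\<^sup>2 * \<epsilon>"] t by simp
  qed (rule int; auto)
  have far2: "(LBINT t:{2<..h}. h\<^sup>2 * \<epsilon>) = (h - 2) * (h\<^sup>2 * \<epsilon>)"
    using set_integral_const[of "{2<..h}" lborel "h\<^sup>2 * \<epsilon>"] h by (simp add: emeasure_lborel_Ioc)
  have "(h - 2) * (h\<^sup>2 * \<epsilon>) \<le> h * (h\<^sup>2 * \<epsilon>)"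
    using \<epsilon> by (intro mult_right_mono) auto
  hence "(h - 2) * (h\<^sup>2 * \<epsilon>) \<le> h ^ 3 * \<epsilon>"
    by (simp only: power3_eq_cube power2_eq_square mult.assoc)
  hence "(LBINT t:{2<..h}. ?w t) \<le> h ^ 3 * \<epsilon>" using far1 far2 by linarith
  moreover have "(LBINT t:{0..2}. ?w t) \<le> 2 * pi / \<kappa> ^ 3"
    using near1 near2 near3 by (simp add: mult.commute)
  ultimately show ?thesis using split by linarith
qed


section \<open>The normalized density\<close>

text \<open>Invariant under scaling of \<open>V\<close>, which is why the normalization
  \<open>V \<le> 1\<close> leaves the density in question unchanged.\<close>

definition weight_density :: "real \<Rightarrow> real" where
  "weight_density t = indicator {0..} t * (exp (- t) * V t) / mass"

lemma density_nonneg: "weight_density t \<ge> 0"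
  by (simp add: weight_density_def V_nonneg mass_nonneg)

lemma density_measurable [measurable]: "weight_density \<in> borel_measurable borel"
  unfolding weight_density_def[abs_def] by measurable

lemma density_le: "weight_density t \<le> 1 / mass"
proof -
  have "exp (- t) * V t \<le> 1 * 1" if "t \<ge> 0"
    using that V_le_1 V_nonneg by (intro mult_mono) auto
  thus ?thesis using mass_nonneg
    by (auto simp: weight_density_def indicator_def intro!: divide_right_mono)
qed

lemma density_integral:
  assumes "mass > 0"
  shows "has_bochner_integral lborel weight_density 1"
proof -
  have "has_bochner_integral lborel (\<lambda>t. indicator {0..} t *\<^sub>R (exp (- t) * V t) / mass) (mass / mass)"
    using mass_integrable unfolding mass_def set_lebesgue_integral_def set_integrable_def
    by (intro has_bochner_integral_divide_zero has_bochner_integral_integrable)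
  thus ?thesis using assms by (simp add: weight_density_def[abs_def])
qed

lemma density_moment1: "has_bochner_integral lborel (\<lambda>t. weight_density t * (t - 1)) (moment1 / mass)"
proof -
  have "has_bochner_integral lborel (\<lambda>t. indicator {0..} t *\<^sub>R ((t - 1) * (exp (- t) * V t)) / mass) (moment1 / mass)"
    using moment1_integrable unfolding moment1_def set_lebesgue_integral_def set_integrable_def
    by (intro has_bochner_integral_divide_zero has_bochner_integral_integrable)
  thus ?thesis by (simp add: weight_density_def[abs_def] mult_ac)
qed

lemma density_moment2: "has_bochner_integral lborel (\<lambda>t. weight_density t * (t - 1)\<^sup>2) (moment2 / mass)"
proof -
  have "has_bochner_integral lborel (\<lambda>t. indicator {0..} t *\<^sub>R ((t - 1)\<^sup>2 * (exp (- t) * V t)) / mass) (moment2 / mass)"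
    using moment2_integrable unfolding moment2_def set_lebesgue_integral_def set_integrable_def
    by (intro has_bochner_integral_divide_zero has_bochner_integral_integrable)
  thus ?thesis by (simp add: weight_density_def[abs_def] mult_ac)
qed

lemma prob_density_halfline_density:
  assumes "mass > 0"
  shows "prob_density_halfline weight_density"
proof -
  have "(\<integral>\<^sup>+ t. ennreal (weight_density t) \<partial>lborel) = ennreal 1"
    using density_integral[OF assms] density_nonneg
    by (subst nn_integral_eq_integral) (auto simp: has_bochner_integral_iff)
  thus ?thesis
    unfolding prob_density_halfline_def using density_nonneg by (auto simp: weight_density_def)
qed

lemma density_mean:
  assumes "mass > 0"
  shows "(LBINT t. weight_density t * t) = 1 + moment1 / mass"
proof -
  have "has_bochner_integral lborel (\<lambda>t. weight_density t + weight_density t * (t - 1)) (1 + moment1 / mass)"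
    by (intro has_bochner_integral_add density_integral density_moment1 assms)
  thus ?thesis by (simp add: has_bochner_integral_iff algebra_simps)
qed

lemma density_second_moment:
  assumes "mass > 0"
  shows "has_bochner_integral lborel (\<lambda>t. weight_density t * (t - \<mu>)\<^sup>2)
           (moment2 / mass - 2 * (\<mu> - 1) * (moment1 / mass) + (\<mu> - 1)\<^sup>2)"
proof -
  have "has_bochner_integral lborel
      (\<lambda>t. weight_density t * (t - 1)\<^sup>2 - 2 * (\<mu> - 1) * (weight_density t * (t - 1)) + (\<mu> - 1)\<^sup>2 * weight_density t)
      (moment2 / mass - 2 * (\<mu> - 1) * (moment1 / mass) + (\<mu> - 1)\<^sup>2 * 1)"
    by (intro has_bochner_integral_add has_bochner_integral_diff has_bochner_integral_mult_right
              density_integral density_moment1 density_moment2 assms)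
  also have "(\<lambda>t. weight_density t * (t - 1)\<^sup>2 - 2 * (\<mu> - 1) * (weight_density t * (t - 1)) + (\<mu> - 1)\<^sup>2 * weight_density t)
      = (\<lambda>t. weight_density t * (t - \<mu>)\<^sup>2)"
    by (simp add: fun_eq_iff power2_eq_square algebra_simps)
  finally show ?thesis by simp
qed

context
  fixes M :: "'a measure" and X :: "'a \<Rightarrow> real"
  assumes prob: "prob_space M" and X: "distributed M lborel X (\<lambda>t. ennreal (weight_density t))"
    and mass_pos: "mass > 0"
begin

lemma expectation_eq: "prob_space.expectation M X = 1 + moment1 / mass"
  using distributed_integral[OF X, of "\<lambda>t. t"] density_nonneg density_mean[OF mass_pos] by simp

lemma variance_eq_integral:
  "prob_space.variance M X = (LBINT t. weight_density t * (t - prob_space.expectation M X)\<^sup>2)"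
  using distributed_integral[OF X, of "\<lambda>t. (t - prob_space.expectation M X)\<^sup>2"] density_nonneg by simp

text \<open>The second moment about 1 exceeds the variance by the square of the offset of the mean
  from 1.\<close>

lemma variance_le: "prob_space.variance M X \<le> moment2 / mass"
proof -
  have "prob_space.variance M X = moment2 / mass - (moment1 / mass)\<^sup>2"
    using density_second_moment[OF mass_pos, of "1 + moment1 / mass"]
    by (subst variance_eq_integral) (simp add: has_bochner_integral_iff expectation_eq power2_eq_square)
  thus ?thesis by simp
qed

lemma variance_ge: "prob_space.variance M X \<ge> mass\<^sup>2 / 32"
proof -
  have "1 / (32 * (1 / mass)\<^sup>2) \<le> prob_space.variance M X"
    unfolding variance_eq_integral using density_integral[OF mass_pos] density_second_moment[OF mass_pos] mass_pos
    by (intro second_moment_ge_of_bounded_density density_nonneg density_le)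
       (auto simp: has_bochner_integral_iff)
  thus ?thesis using mass_pos by (simp add: power_divide)
qed

lemma expectation_bound: "\<bar>prob_space.expectation M X - 1\<bar> \<le> exp 1 * (moment2 / mass)"
  using divide_right_mono[OF moment1_bound mass_nonneg] mass_pos
  unfolding expectation_eq by (simp add: abs_divide)

end

end

section \<open>Powered Fejer densities\<close>

text \<open>Retains the quadratic term of the binomial expansion. With x quadratic in t - 1 this is
  the source of the quartic decay, and r enters to the same power as x.\<close>

lemma one_plus_power_ge:
  assumes "x \<ge> 0" "r \<ge> 2"
  shows "(1 + x) ^ r \<ge> 1 + (real r * x / 2)\<^sup>2"
proof -
  have lower: "(1 + x) ^ r \<ge> 1 + real r * x + real r * (real r - 1) / 2 * x\<^sup>2"
  proof (induction r)
    case (Suc r)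
    define c where "c = real r * (real r - 1) / 2"
    have "c \<ge> 0" by (cases r) (auto simp: c_def)
    have "real (Suc r) * (real (Suc r) - 1) / 2 = c + real r"
      by (simp add: c_def field_simps)
    \<comment> \<open>\<open>c\<close> is the binomial coefficient r over 2; the product overshoots
      the desired quadratic by \<open>c * x ^ 3\<close> only.\<close>
    hence "1 + real (Suc r) * x + real (Suc r) * (real (Suc r) - 1) / 2 * x\<^sup>2
        = (1 + real r * x + c * x\<^sup>2) * (1 + x) - c * x ^ 3"
      by (simp only:) (simp add: algebra_simps power2_eq_square power3_eq_cube)
    also have "\<dots> \<le> (1 + real r * x + c * x\<^sup>2) * (1 + x)"
      using \<open>c \<ge> 0\<close> assms by simp
    also have "\<dots> \<le> (1 + x) ^ r * (1 + x)"
      using Suc.IH assms unfolding c_def by (intro mult_right_mono) auto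
    finally show ?case by (simp add: mult.commute)
  qed simp
  \<comment> \<open>For r at least 2, r^2 / 4 is at most r (r - 1) / 2.\<close>
  have "2 * real r \<le> real r * real r"
    using assms by (intro mult_right_mono) auto
  hence "0 \<le> (real r * real r - 2 * real r) / 4" by simp
  also have "\<dots> = real r * (real r - 1) / 2 - (real r / 2)\<^sup>2"
    by (simp add: power2_eq_square algebra_simps diff_divide_distrib)
  finally have "(real r / 2)\<^sup>2 \<le> real r * (real r - 1) / 2"
    by (simp only: diff_ge_0_iff_ge)
  hence "(real r / 2)\<^sup>2 * x\<^sup>2 \<le> real r * (real r - 1) / 2 * x\<^sup>2"
    by (intro mult_right_mono) auto
  moreover have "real r * x \<ge> 0" using assms by simp
  moreover have "(real r * x / 2)\<^sup>2 = (real r / 2)\<^sup>2 * x\<^sup>2"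
    by (simp add: power_divide power_mult_distrib)
  ultimately show ?thesis using lower by linarith
qed

section \<open>The powered kernel as a periodic weight\<close>

definition pf_weight :: "nat \<Rightarrow> real \<Rightarrow> real" where
  "pf_weight m t = (fejer m (pf_freq m * (t - 1)) / real m) ^ pf_power m"

lemma half_less_ln:
  assumes "m \<ge> 2"
  shows "ln (real m) > 1 / 2"
proof -
  have "exp (1 / 2) < (2::real)"
  proof -
    have "exp (1/2) ^ 2 = exp (1::real)" by (simp flip: exp_of_nat_mult)
    also have "\<dots> < 2 ^ 2" using exp_le by simp
    finally show ?thesis by (rule power_less_imp_less_base) simp
  qed
  also have "2 \<le> real m" using assms by simp
  finally show ?thesis using assms by (simp add: ln_less_cancel_iff[symmetric, of "exp (1 / 2)"])
qed

lemma pf_power_bounds: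
  assumes "m \<ge> 2"
  shows "real (pf_power m) \<ge> ln (real m)" "real (pf_power m) \<le> ln (real m) + 1" "pf_power m \<ge> 1"
proof -
  have "ln (real m) > 1 / 2" using half_less_ln[OF assms] .
  hence c: "\<lceil>ln (real m)\<rceil> > 0" by (simp add: zero_less_ceiling)
  have r: "real (pf_power m) = of_int \<lceil>ln (real m)\<rceil>"
    using c by (simp add: pf_power_def)
  show "real (pf_power m) \<ge> ln (real m)" "real (pf_power m) \<le> ln (real m) + 1"
    unfolding r by linarith+
  show "pf_power m \<ge> 1" using c unfolding pf_power_def by linarith
qed

text \<open>For small m the iterated logarithm is negative. From ln m > 1/2 it is above -ln 2 > -1,
  while \<open>2 * ln (real m)\<close> is above 1.\<close>

lemma pf_period_pos:
  assumes "m \<ge> 2"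
  shows "pf_period m > 0"
proof -
  have L: "ln (real m) > 1 / 2" using half_less_ln[OF assms] .
  have "ln 2 < (1::real)" using ln_2_less_1 by simp
  moreover have "ln (1 / 2) < ln (ln (real m))"
    using L by (subst ln_less_cancel_iff) auto
  ultimately have "ln (ln (real m)) > - 1"
    by (simp add: ln_div)
  thus ?thesis using L by (simp add: pf_period_def)
qed

lemma pf_freq_pos: "m \<ge> 2 \<Longrightarrow> pf_freq m > 0"
  using pf_period_pos[of m] by (simp add: pf_freq_def)

lemma pf_weight_eq: "m > 0 \<Longrightarrow> powered_fejer m (pf_freq m * (t - 1)) = real m ^ pf_power m * pf_weight m t"
  by (simp add: powered_fejer_def pf_weight_def power_divide)

lemma periodic_weight_pf:
  assumes "m \<ge> 2"
  shows "periodic_weight (pf_weight m) (pf_period m)"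
proof
  have m: "m > 0" using assms by simp
  show "continuous_on UNIV (pf_weight m)"
    unfolding pf_weight_def[abs_def] using m by (intro continuous_intros) auto
  fix t
  show "pf_weight m t \<ge> 0"
    unfolding pf_weight_def using fejer_nonneg[OF m] by simp
  show "pf_weight m t \<le> 1"
    unfolding pf_weight_def using fejer_nonneg[OF m] fejer_le[OF m] m by (intro power_le_one) auto
  have "pf_freq m * (t + pf_period m - 1) = pf_freq m * (t - 1) + 2 * pi"
    using pf_period_pos[OF assms] by (simp add: pf_freq_def field_simps)
  thus "pf_weight m (t + pf_period m) = pf_weight m t"
    unfolding pf_weight_def by (simp only: fejer_periodic)
  have "pf_freq m * (2 - t - 1) = - (pf_freq m * (t - 1))"
    by (simp add: algebra_simps)
  thus "pf_weight m (2 - t) = pf_weight m t"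
    unfolding pf_weight_def by (simp only: fejer_minus)
qed

text \<open>Bernoulli's inequality applied to the parabola under the kernel: the r-th power stays
  above 1 - r x, so the peak keeps half its height on a width of order 1 / (m omega sqrt r).\<close>

lemma pf_weight_ge_half:
  assumes "m \<ge> 2" and t: "2 * real (pf_power m) * (real m * pf_freq m * (t - 1))\<^sup>2 \<le> 1"
  shows "pf_weight m t \<ge> 1 / 2"
proof -
  let ?x = "(real m * pf_freq m * (t - 1))\<^sup>2" and ?r = "pf_power m"
  have m: "m > 0" using assms by simp
  have x: "real ?r * ?x \<le> 1 / 2" using t by simp
  have "1 * ?x \<le> real ?r * ?x"
    using pf_power_bounds(3)[OF assms(1)] by (intro mult_right_mono) auto
  hence x1: "?x \<le> 1" using x by simp
  have "1 / 2 \<le> 1 + real ?r * (- ?x)" using x by simp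
  also have "\<dots> \<le> (1 + (- ?x)) ^ ?r"
    using x1 by (intro Bernoulli_inequality) simp
  also have "\<dots> \<le> (fejer m (pf_freq m * (t - 1)) / real m) ^ ?r"
  proof (rule power_mono)
    have "real m * (1 - ?x) \<le> fejer m (pf_freq m * (t - 1))"
      using fejer_ge[OF m, of "pf_freq m * (t - 1)"] by (simp only: mult.assoc)
    thus "1 + (- ?x) \<le> fejer m (pf_freq m * (t - 1)) / real m"
      using m by (simp add: pos_le_divide_eq mult.commute)
  qed (use x1 in simp)
  finally show ?thesis by (simp add: pf_weight_def)
qed

text \<open>Qualitative only, but valid from \<open>m = 2\<close> on, as the statement about the
  order requires.\<close>

lemma pf_mass_pos:
  assumes "m \<ge> 2"
  shows "periodic_weight.mass (pf_weight m) > 0"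
proof -
  interpret W: periodic_weight "pf_weight m" "pf_period m"
    by (rule periodic_weight_pf[OF assms])
  define a where "a = 2 * real (pf_power m) * (real m * pf_freq m)\<^sup>2"
  \<comment> \<open>This choice gives both \<open>\<delta> \<le> 1\<close> and
    \<open>a * \<delta>\<^sup>2 \<le> 1\<close>, whatever the size of \<open>a\<close>.\<close>
  define \<delta> where "\<delta> = 1 / (1 + a)"
  have a: "a \<ge> 0" by (simp add: a_def)
  hence \<delta>: "0 < \<delta>" "\<delta> \<le> 1" by (auto simp: \<delta>_def)
  have "W.mass \<ge> exp (- 2) * \<delta> / 2"
  proof (rule W.mass_ge)
    fix t assume t: "1 \<le> t" "t \<le> 1 + \<delta>"
    have "2 * real (pf_power m) * (real m * pf_freq m * (t - 1))\<^sup>2 = a * (t - 1)\<^sup>2"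
      by (simp add: a_def power_mult_distrib)
    also have "\<dots> \<le> a * \<delta>\<^sup>2"
      using t a by (intro mult_left_mono power_mono) auto
    also have "\<dots> \<le> (1 + a) * \<delta> * \<delta>"
      using \<delta> by (simp add: power2_eq_square algebra_simps)
    also have "\<dots> \<le> 1"
      using a \<delta> by (simp add: \<delta>_def)
    finally show "pf_weight m t \<ge> 1 / 2"
      by (rule pf_weight_ge_half[OF assms])
  qed (use \<delta> in auto)
  moreover have "exp (- 2) * \<delta> / 2 > 0" using \<delta> by simp
  ultimately show ?thesis by linarith
qed

lemma pf_cme_eq_weight_density:
  assumes "m \<ge> 2"
  shows "pf_cme m = periodic_weight.weight_density (pf_weight m)"
proof
  fix t
  interpret W: periodic_weight "pf_weight m" "pf_period m"
    by (rule periodic_weight_pf[OF assms])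
  have m: "m > 0" using assms by simp
  have "(LBINT t:{0..}. exp (- t) * powered_fejer m (pf_freq m * (t - 1)))
      = (LBINT t:{0..}. real m ^ pf_power m * (exp (- t) * pf_weight m t))"
    by (simp only: pf_weight_eq[OF m] mult.left_commute)
  also have "\<dots> = real m ^ pf_power m * W.mass"
    by (simp only: set_integral_mult_right W.mass_def)
  finally show "pf_cme m t = W.weight_density t"
    using m pf_weight_eq[OF m, of t]
    by (simp add: pf_cme_def pf_cme_const_def W.weight_density_def)
qed

lemma pf_cme_order:
  assumes "m \<ge> 2"
  shows "matrix_exponential (pf_cme m)"
    and "min_me_order (pf_cme m) = 2 * pf_power m * (m - 1) + 1"
proof -
  interpret W: periodic_weight "pf_weight m" "pf_period m"
    by (rule periodic_weight_pf[OF assms])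
  have m: "m > 0" using assms by simp
  define K where "K = pf_power m * (m - 1)"
  define \<omega> where "\<omega> = pf_freq m"
  have \<omega>: "\<omega> > 0" using pf_freq_pos[OF assms] by (simp add: \<omega>_def)
  obtain c where c: "\<And>j. j \<le> 2 * K \<Longrightarrow> c j > 0"
    "\<And>\<theta>. complex_of_real (fejer m \<theta> ^ pf_power m) = (\<Sum>j\<le>2*K. of_real (c j) * cis ((real j - real K) * \<theta>))"
    using fejer_power_cis_expansion[OF m, of "pf_power m"] unfolding K_def by blast
  define D where "D = 1 / (real m ^ pf_power m * W.mass)"
  have D: "D > 0" using m pf_mass_pos[OF assms] by (simp add: D_def)
  \<comment> \<open>Placing the peak at \<open>t = 1\<close> only multiplies the coefficients by
    phases of modulus one, so they stay nonzero; a positive frequency keeps the exponents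
    distinct.\<close>
  define z where "z j = Complex (- 1) ((real j - real K) * \<omega>)" for j :: nat
  define a where "a j = of_real (D * c j) * cis (- ((real j - real K) * \<omega>))" for j
  have "\<exists>p q. rational_laplace (pf_cme m) p q \<and> degree q = card {..2 * K}"
  proof (rule rational_laplace_exp_sum)
    show "inj_on z {..2 * K}"
      using \<omega> by (auto simp: inj_on_def z_def)
    show "Re (z j) < 0" for j by (simp add: z_def)
    show "a j \<noteq> 0" if "j \<in> {..2 * K}" for j
      using D c(1)[of j] that by (simp add: a_def)
  next
    fix t :: real assume t: "t \<ge> 0"
    have "pf_cme m t = D * (exp (- t) * fejer m (\<omega> * (t - 1)) ^ pf_power m)"
      using t m by (simp add: pf_cme_eq_weight_density[OF assms] W.weight_density_def D_def
          pf_weight_def \<omega>_def power_divide)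
    hence "of_real (pf_cme m t) = of_real D * (of_real (exp (- t)) *
        (\<Sum>j\<le>2*K. of_real (c j) * cis ((real j - real K) * (\<omega> * (t - 1)))))"
      by (simp only: of_real_mult c(2))
    also have "\<dots> = (\<Sum>j\<le>2*K. a j * exp (z j * of_real t))"
      unfolding sum_distrib_left
    proof (intro sum.cong refl)
      fix j
      have "exp (z j * of_real t) = of_real (exp (- t)) * cis ((real j - real K) * \<omega> * t)"
        by (simp add: complex_eq_iff exp_eq_polar z_def Re_exp Im_exp)
      moreover have "cis ((real j - real K) * (\<omega> * (t - 1)))
          = cis (- ((real j - real K) * \<omega>)) * cis ((real j - real K) * \<omega> * t)"
        by (simp add: cis_mult algebra_simps)
      ultimately show "of_real D * (of_real (exp (- t)) * (of_real (c j) * cis ((real j - real K) * (\<omega> * (t - 1)))))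
          = a j * exp (z j * of_real t)"
        by (simp add: a_def)
    qed
    finally show "of_real (pf_cme m t) = (\<Sum>j\<le>2*K. a j * exp (z j * of_real t))" .
  qed auto
  then obtain p q where pq: "rational_laplace (pf_cme m) p q" "degree q = 2 * K + 1"
    by auto
  show "matrix_exponential (pf_cme m)"
    unfolding matrix_exponential_def
    using W.prob_density_halfline_density[OF pf_mass_pos[OF assms]] pq(1)
    by (auto simp: pf_cme_eq_weight_density[OF assms])
  show "min_me_order (pf_cme m) = 2 * pf_power m * (m - 1) + 1"
    using min_me_order_eq_degree[OF pq(1)] pq(2) by (simp add: K_def)
qed

section \<open>Quantitative estimates for large m\<close>

text \<open>The threshold 4 gives a period of at least 8 > 2 pi, hence frequency at most 1, so that
  \<open>\<bar>t - 1\<bar> \<le> 1\<close> stays in the range of the inverse-square bound on the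
  kernel.\<close>

lemma pf_parameter_bounds:
  assumes "m \<ge> 2" and L: "ln (real m) \<ge> 4"
  shows "real (pf_power m) \<le> 2 * ln (real m)" "pf_power m \<ge> 3"
    "pf_period m \<ge> 2 * ln (real m)" "pf_period m \<le> 3 * ln (real m)"
    "exp (- pf_period m) = 1 / ((real m)\<^sup>2 * ln (real m))"
    "pf_freq m \<le> 1"
proof -
  note r = pf_power_bounds[OF assms(1)]
  show "real (pf_power m) \<le> 2 * ln (real m)" using r L by linarith
  show "pf_power m \<ge> 3" using r L by linarith
  have "ln (ln (real m)) \<ge> 0" using L by simp
  moreover have "ln (ln (real m)) \<le> ln (real m)"
    using ln_le_minus_one[of "ln (real m)"] L by linarith
  ultimately show h: "pf_period m \<ge> 2 * ln (real m)" "pf_period m \<le> 3 * ln (real m)"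
    by (auto simp: pf_period_def)
  have "exp (pf_period m) = (exp (ln (real m)))\<^sup>2 * exp (ln (ln (real m)))"
    by (simp add: pf_period_def exp_add exp_double)
  also have "\<dots> = (real m)\<^sup>2 * ln (real m)"
    using assms by simp
  finally show "exp (- pf_period m) = 1 / ((real m)\<^sup>2 * ln (real m))"
    by (simp add: exp_minus inverse_eq_divide)
  have "2 * pi \<le> pf_period m" using h(1) L pi_less_4 by linarith
  thus "pf_freq m \<le> 1"
    using pf_period_pos[OF assms(1)] by (simp add: pf_freq_def)
qed

lemma pf_mass_ge:
  assumes "m \<ge> 2" and L: "ln (real m) \<ge> 4"
  shows "periodic_weight.mass (pf_weight m) \<ge> sqrt (ln (real m)) / (144 * real m)"
proof -
  interpret W: periodic_weight "pf_weight m" "pf_period m"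
    by (rule periodic_weight_pf[OF assms(1)])
  note b = pf_parameter_bounds[OF assms]
  define L where "L = ln (real m)"
  have m: "real m > 0" using assms by simp
  \<comment> \<open>Chosen so that m omega delta = sqrt L / h, which is at most 1 / (2 sqrt L); with
    r at most 2 L the half-height condition then holds.\<close>
  define \<delta> where "\<delta> = sqrt L / (2 * pi * real m)"
  have L4: "L \<ge> 4" using L by (simp add: L_def)
  have \<delta>0: "\<delta> \<ge> 0" using L4 m by (simp add: \<delta>_def)
  have "sqrt L \<le> L" using L4 by (intro real_le_lsqrt) (auto simp: power2_eq_square mult_le_cancel_left1)
  also have "L \<le> real m" unfolding L_def using m ln_le_minus_one[of "real m"] by simp
  also have "\<dots> \<le> 2 * pi * real m" using pi_gt3 m mult_right_mono[of 1 "2 * pi" "real m"] by simp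
  finally have \<delta>1: "\<delta> \<le> 1" using m by (simp add: \<delta>_def)
  have "W.mass \<ge> exp (- 2) * \<delta> / 2"
  proof (rule W.mass_ge[OF \<delta>0 \<delta>1])
    fix t assume t: "1 \<le> t" "t \<le> 1 + \<delta>"
    have "real m * pf_freq m * (t - 1) \<le> real m * pf_freq m * \<delta>"
      using t pf_freq_pos[OF assms(1)] by (intro mult_left_mono) auto
    also have "\<dots> = sqrt L / pf_period m"
      using m by (simp add: \<delta>_def pf_freq_def)
    finally have "(real m * pf_freq m * (t - 1))\<^sup>2 \<le> (sqrt L / pf_period m)\<^sup>2"
      using t pf_freq_pos[OF assms(1)] by (intro power_mono) auto
    also have "\<dots> = L / (pf_period m)\<^sup>2" using L4 by (simp add: power_divide)
    also have "\<dots> \<le> L / (2 * L)\<^sup>2"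
      using b(3) L4 unfolding L_def by (intro divide_left_mono power_mono) auto
    also have "\<dots> = 1 / (4 * L)" using L4 by (simp add: power2_eq_square)
    finally have "2 * real (pf_power m) * (real m * pf_freq m * (t - 1))\<^sup>2 \<le> (2 * (2 * L)) * (1 / (4 * L))"
      using b(1) L4 unfolding L_def by (intro mult_mono) auto
    also have "\<dots> = 1" using L4 by simp
    finally show "pf_weight m t \<ge> 1 / 2"
      by (rule pf_weight_ge_half[OF assms(1)])
  qed
  \<comment> \<open>The constant is 144 = 9 * 8 * 2, from e^2 at most 9, 2 pi at most 8 and the half
    height.\<close>
  moreover have "exp (- 2) * \<delta> / 2 \<ge> 1 / 9 * (sqrt L / (8 * real m)) / 2"
  proof -
    have "exp 2 = (exp (1::real))\<^sup>2" by (simp flip: exp_double)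
    also have "\<dots> \<le> (3::real)\<^sup>2" using exp_le by (intro power_mono) auto
    finally have "exp (- 2) \<ge> (1 / 9 :: real)"
      by (simp add: exp_minus inverse_eq_divide field_simps)
    moreover have "\<delta> \<ge> sqrt L / (8 * real m)"
      unfolding \<delta>_def using m L4 pi_less_4 by (intro divide_left_mono mult_right_mono) auto
    ultimately have "exp (- 2) * \<delta> \<ge> 1 / 9 * (sqrt L / (8 * real m))"
      using L4 by (intro mult_mono) auto
    thus ?thesis by (rule divide_right_mono) simp
  qed
  ultimately show ?thesis by (simp add: L_def)
qed

lemma pf_weight_le_near:
  assumes "m \<ge> 2" and L: "ln (real m) \<ge> 4" and t: "\<bar>t - 1\<bar> \<le> 1"
  shows "pf_weight m t \<le> 1 / (1 + (real m / sqrt (32 * ln (real m)) * (t - 1)) ^ 4)"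
proof -
  note b = pf_parameter_bounds[OF assms(1,2)]
  define L where "L = ln (real m)"
  define r where "r = pf_power m"
  define h where "h = pf_period m"
  have L4: "L \<ge> 4" and hL: "0 < h" "h \<le> 3 * L" and rL: "L \<le> real r" "r \<ge> 3"
    using L b(2,4) pf_period_pos[OF assms(1)] pf_power_bounds(1)[OF assms(1)] by (auto simp: L_def h_def r_def)
  have m: "real m > 0" using assms by simp
  define x where "x = (real m * (pf_freq m * (t - 1)))\<^sup>2 / 64"
  have x: "x \<ge> 0" by (simp add: x_def)
  have "\<bar>pf_freq m * (t - 1)\<bar> \<le> 1 * 1"
    using b(6) t pf_freq_pos[OF assms(1)] unfolding abs_mult by (intro mult_mono) auto
  hence "fejer m (pf_freq m * (t - 1)) \<le> real m / (1 + x)"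
    unfolding x_def by (intro fejer_le_inverse_square assms(1)) simp
  hence "fejer m (pf_freq m * (t - 1)) / real m \<le> 1 / (1 + x)"
    using m x by (simp add: field_simps)
  hence "pf_weight m t \<le> (1 / (1 + x)) ^ r"
    unfolding pf_weight_def r_def using fejer_nonneg[of m] m by (intro power_mono) auto
  also have "\<dots> = 1 / (1 + x) ^ r" by (simp add: power_divide)
  also have "\<dots> \<le> 1 / (1 + (real r * x / 2)\<^sup>2)"
    using one_plus_power_ge[OF x, of r] rL x by (intro divide_left_mono) (auto intro!: mult_pos_pos add_pos_nonneg)
  also have "\<dots> \<le> 1 / (1 + ((real m)\<^sup>2 * (t - 1)\<^sup>2 / (32 * L))\<^sup>2)"
  proof -
    \<comment> \<open>The lower bound pi > 3 cancels the 3 in \<open>h \<le> 3 * L\<close>, and r at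
      least L leaves 1 / L. The 32 is 64 * 2 / 4, where the 4 comes from the square of 2 pi /
      h.\<close>
    have "4 * h\<^sup>2 \<le> 4 * (9 * L\<^sup>2)"
      using hL power_mono[of h "3 * L" 2] by (simp add: power_mult_distrib)
    also have "\<dots> = L * L * 4 * 3\<^sup>2" by (simp add: power2_eq_square)
    also have "\<dots> \<le> real r * L * 4 * pi\<^sup>2"
      using rL L4 pi_gt3 by (intro mult_mono power_mono) auto
    finally have "1 / L \<le> real r * pi\<^sup>2 / h\<^sup>2"
      using L4 hL by (simp add: field_simps)
    hence "(real m)\<^sup>2 * (t - 1)\<^sup>2 / 32 * (1 / L) \<le> (real m)\<^sup>2 * (t - 1)\<^sup>2 / 32 * (real r * pi\<^sup>2 / h\<^sup>2)"
      by (intro mult_left_mono) auto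
    also have "\<dots> = real r * x / 2"
      by (simp add: x_def pf_freq_def h_def power_mult_distrib power_divide)
    finally have "((real m)\<^sup>2 * (t - 1)\<^sup>2 / (32 * L))\<^sup>2 \<le> (real r * x / 2)\<^sup>2"
      using L4 by (intro power_mono) auto
    thus ?thesis by (intro divide_left_mono) (auto intro!: mult_pos_pos add_pos_nonneg)
  qed
  also have "((real m)\<^sup>2 * (t - 1)\<^sup>2 / (32 * L))\<^sup>2 = (real m / sqrt (32 * L) * (t - 1)) ^ 4"
  proof -
    have "(real m / sqrt (32 * L) * (t - 1))\<^sup>2 = (real m)\<^sup>2 * (t - 1)\<^sup>2 / (32 * L)"
      using L4 by (simp add: power_mult_distrib power_divide)
    hence "((real m / sqrt (32 * L) * (t - 1))\<^sup>2)\<^sup>2 = ((real m)\<^sup>2 * (t - 1)\<^sup>2 / (32 * L))\<^sup>2"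
      by simp
    thus ?thesis by (simp only: power_mult[symmetric]) simp
  qed
  finally show ?thesis unfolding L_def .
qed

text \<open>The exponent 6 comes from r at least 3. After multiplication by h^3 and division by the
  mass, the far part is of order (ln m)^(17/2) / m^5, well below ln m / m^2.\<close>

lemma pf_weight_le_far:
  assumes "m \<ge> 2" and L: "ln (real m) \<ge> 4" and small: "3 * ln (real m) \<le> 2 * real m"
    and t: "2 \<le> t" "t \<le> pf_period m"
  shows "pf_weight m t \<le> (3 * ln (real m) / (2 * real m)) ^ 6"
proof -
  note b = pf_parameter_bounds[OF assms(1,2)]
  define h where "h = pf_period m"
  have h: "h > 0" using pf_period_pos[OF assms(1)] by (simp add: h_def)
  have m: "real m > 0" using assms by simp
  let ?\<omega> = "pf_freq m"
  have \<omega>: "?\<omega> > 0" by (rule pf_freq_pos[OF assms(1)])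
  \<comment> \<open>For t in [2, h] both the peak at 1 and its copy at 1 + h are at distance at
    least 1, so the angle stays omega away from 0 and 2 pi.\<close>
  have "?\<omega> * (t - 1) \<le> ?\<omega> * (h - 1)"
    using t \<omega> unfolding h_def by (intro mult_left_mono) auto
  also have "\<dots> = 2 * pi - ?\<omega>"
    using h by (simp add: pf_freq_def h_def field_simps)
  finally have "?\<omega> * (t - 1) \<le> 2 * pi - ?\<omega>" .
  moreover have "?\<omega> * 1 \<le> ?\<omega> * (t - 1)"
    using t \<omega> by (intro mult_left_mono) auto
  ultimately have "fejer m (?\<omega> * (t - 1)) \<le> real m * (pi / (real m * ?\<omega>))\<^sup>2"
    using m \<omega> by (intro fejer_le_off_peak) auto
  also have "pi / (real m * ?\<omega>) = h / (2 * real m)"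
    using h by (simp add: pf_freq_def h_def)
  finally have "fejer m (?\<omega> * (t - 1)) / real m \<le> (h / (2 * real m))\<^sup>2"
    using m by (simp add: field_simps)
  also have "\<dots> \<le> (3 * ln (real m) / (2 * real m))\<^sup>2"
    using b(4) h m by (intro power_mono divide_right_mono) (auto simp: h_def)
  finally have "pf_weight m t \<le> ((3 * ln (real m) / (2 * real m))\<^sup>2) ^ pf_power m"
    unfolding pf_weight_def using fejer_nonneg[of m] m by (intro power_mono) auto
  also have "\<dots> \<le> ((3 * ln (real m) / (2 * real m))\<^sup>2) ^ 3"
    using b(2) small L m by (intro power_decreasing power_le_one) auto
  finally show ?thesis by (simp flip: power_mult)
qed

text \<open>The central period is divided by the lower bound on the mass; in the folded tail the
  mass cancels exactly.\<close>

lemma pf_moment2_ratio_le: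
  assumes "m \<ge> 2" and L: "ln (real m) \<ge> 4" and small: "3 * ln (real m) \<le> 2 * real m"
  shows "periodic_weight.moment2 (pf_weight m) / periodic_weight.mass (pf_weight m)
    \<le> 2 * (2 * pi / (real m / sqrt (32 * ln (real m))) ^ 3
          + (3 * ln (real m)) ^ 3 * (3 * ln (real m) / (2 * real m)) ^ 6)
        / (sqrt (ln (real m)) / (144 * real m))
      + 36 * ln (real m) / (real m)\<^sup>2"
proof -
  interpret W: periodic_weight "pf_weight m" "pf_period m"
    by (rule periodic_weight_pf[OF assms(1)])
  note b = pf_parameter_bounds[OF assms(1,2)]
  define L where "L = ln (real m)"
  define h where "h = pf_period m"
  have m: "real m > 0" using assms by simp
  have L4: "L \<ge> 4" using L by (simp add: L_def)
  have hL: "2 * L \<le> h" "h \<le> 3 * L" using b by (auto simp: h_def L_def)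
  have e: "exp (- h) = 1 / ((real m)\<^sup>2 * L)" using b(5) by (simp add: h_def L_def)
  define \<epsilon> where "\<epsilon> = (3 * L / (2 * real m)) ^ 6"
  define A where "A = 2 * (2 * pi / (real m / sqrt (32 * L)) ^ 3 + (3 * L) ^ 3 * \<epsilon>)"
  have "\<epsilon> \<ge> 0" by (simp add: \<epsilon>_def)
  have "2 * 2 \<le> real m * real m" using assms by (intro mult_mono) auto
  hence m4: "4 \<le> (real m)\<^sup>2" by (simp add: power2_eq_square)
  have "4 * 1 \<le> (real m)\<^sup>2 * L" using m4 L4 by (intro mult_mono) auto
  hence e4: "exp (- h) \<le> 1 / 4" unfolding e using m L4 by (intro divide_left_mono) auto
  let ?S0 = "LBINT t:{0..h}. (t - 1)\<^sup>2 * (exp (- t) * pf_weight m t)"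
  have S0: "?S0 \<le> 2 * pi / (real m / sqrt (32 * L)) ^ 3 + h ^ 3 * \<epsilon>"
    unfolding h_def
  proof (rule W.central_period_bound)
    show "real m / sqrt (32 * L) > 0" using m L4 by simp
    show "2 \<le> pf_period m" using hL L4 by (simp add: h_def)
    show "pf_weight m t \<le> 1 / (1 + (real m / sqrt (32 * L) * (t - 1)) ^ 4)" if "0 \<le> t" "t \<le> 2" for t
      unfolding L_def using that by (intro pf_weight_le_near assms) auto
    show "pf_weight m t \<le> \<epsilon>" if "2 \<le> t" "t \<le> pf_period m" for t
      unfolding \<epsilon>_def L_def using that by (intro pf_weight_le_far assms)
  qed
  have "h ^ 3 * \<epsilon> \<le> (3 * L) ^ 3 * \<epsilon>"
    using hL L4 \<open>\<epsilon> \<ge> 0\<close> by (intro mult_right_mono power_mono) auto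
  hence "2 * ?S0 \<le> A" using S0 by (simp add: A_def)
  moreover have "W.moment2 \<le> 2 * ?S0 + 4 * h\<^sup>2 * exp (- h) * W.mass"
    unfolding h_def using hL L4 e4 by (intro W.moment2_le_period) (auto simp: h_def)
  ultimately have "W.moment2 \<le> A + 4 * h\<^sup>2 * exp (- h) * W.mass" by linarith
  hence "W.moment2 / W.mass \<le> (A + 4 * h\<^sup>2 * exp (- h) * W.mass) / W.mass"
    using W.mass_nonneg by (rule divide_right_mono)
  also have "\<dots> = A / W.mass + 4 * h\<^sup>2 * exp (- h)"
    using pf_mass_pos[OF assms(1)] by (simp add: add_divide_distrib)
  also have "A / W.mass \<le> A / (sqrt L / (144 * real m))"
  proof (rule divide_left_mono)
    show "sqrt L / (144 * real m) \<le> W.mass"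
      using pf_mass_ge[OF assms(1,2)] by (simp add: L_def)
    show "A \<ge> 0" using m L4 \<open>\<epsilon> \<ge> 0\<close> by (simp add: A_def)
    show "0 < W.mass * (sqrt L / (144 * real m))"
      using m L4 pf_mass_pos[OF assms(1)] by simp
  qed
  \<comment> \<open>\<open>h \<le> 3 * L\<close> gives 4 * 9 = 36, and one factor \<open>L\<close>
    cancels against \<open>exp (- h)\<close>.\<close>
  also have "4 * h\<^sup>2 * exp (- h) \<le> 4 * (3 * L)\<^sup>2 * exp (- h)"
    using hL L4 by (intro mult_right_mono mult_left_mono power_mono) auto
  also have "\<dots> = 36 * L / (real m)\<^sup>2"
    unfolding e using m L4 by (simp add: power2_eq_square)
  finally show ?thesis by (simp add: A_def \<epsilon>_def L_def)
qed

section \<open>Asymptotic orders\<close>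

lemma pf_moment2_ratio_asymp:
  "(\<lambda>m. 2 * (2 * pi / (real m / sqrt (32 * ln (real m))) ^ 3
          + (3 * ln (real m)) ^ 3 * (3 * ln (real m) / (2 * real m)) ^ 6)
        / (sqrt (ln (real m)) / (144 * real m))
      + 36 * ln (real m) / (real m)\<^sup>2) \<in> O(\<lambda>m. ln (real m) / (real m)\<^sup>2)"
  by real_asymp

lemma eventually_large_ln:
  "eventually (\<lambda>m. m \<ge> 2 \<and> ln (real m) \<ge> 4 \<and> 3 * ln (real m) \<le> 2 * real m) sequentially"
proof -
  have "eventually (\<lambda>m. ln (real m) \<ge> 4) sequentially" by real_asymp
  moreover have "eventually (\<lambda>m. 3 * ln (real m) \<le> 2 * real m) sequentially" by real_asymp
  ultimately show ?thesis using eventually_ge_at_top[of 2] by eventually_elim auto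
qed

lemma bigtheta_power:
  fixes f g :: "nat \<Rightarrow> real"
  assumes "f \<in> \<Theta>(g)"
  shows "(\<lambda>x. f x ^ k) \<in> \<Theta>(\<lambda>x. g x ^ k)"
  using assms landau_o.big_power[of f _ g k] landau_omega.big_power[of f _ g k]
  by (auto simp: bigtheta_def)

text \<open>The order is comparable to m ln m and its logarithm to ln m, so the quotient is
  comparable to (ln m)^3 / (m ln m)^2.\<close>

lemma pf_order_asymp:
  "(\<lambda>m. ln (real (2 * pf_power m * (m - 1) + 1)) ^ 3 / (real (2 * pf_power m * (m - 1) + 1))\<^sup>2)
     \<in> \<Theta>(\<lambda>m. ln (real m) / (real m)\<^sup>2)"
proof -
  define n where "n m = real (2 * pf_power m * (m - 1) + 1)" for m
  have bounds: "eventually (\<lambda>m. 1 * (real m * ln (real m)) \<le> n m \<and> n m \<le> 4 * (real m * ln (real m))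
      \<and> ln (real m) \<le> ln (n m) \<and> ln (n m) \<le> 4 * ln (real m)) sequentially"
    using eventually_large_ln
  proof eventually_elim
    case (elim m)
    hence m2: "m \<ge> 2" and L: "ln (real m) \<ge> 4" by auto
    define L where "L = ln (real m)"
    define r where "r = real (pf_power m)"
    have r: "L \<le> r" "r \<le> 2 * L" "1 \<le> r"
      using pf_power_bounds[OF m2] pf_parameter_bounds(1)[OF m2 L] by (auto simp: L_def r_def)
    have m: "real m \<ge> 2" using m2 by simp
    have n: "n m = 2 * r * (real m - 1) + 1"
      using m2 by (simp add: n_def r_def of_nat_diff)
    have "L * real m \<le> r * (2 * real m - 2)"
      using r m L by (intro mult_mono) (auto simp: L_def)
    hence lower: "real m * L \<le> n m" by (simp add: n algebra_simps)
    have "n m \<le> 2 * r * real m" using r by (simp add: n algebra_simps)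
    also have "\<dots> \<le> 2 * (2 * L) * real m"
      using r m by (intro mult_right_mono) auto
    finally have upper: "n m \<le> 4 * (real m * L)" by (simp add: mult_ac)
    have "real m * 1 \<le> real m * L" using L m by (intro mult_left_mono) (auto simp: L_def)
    hence "real m \<le> n m" using lower by linarith
    hence ln1: "L \<le> ln (n m)" unfolding L_def using m by simp
    \<comment> \<open>The crude bound of the order by m^4 suffices, as the logarithm turns the
      exponent into a constant factor.\<close>
    have "L \<le> real m" unfolding L_def using m ln_le_minus_one[of "real m"] by simp
    hence "4 * (real m * L) \<le> real m ^ 2 * (real m * real m)"
      using m L power_mono[of 2 "real m" 2] by (intro mult_mono) (auto simp: L_def)
    hence "n m \<le> real m ^ 4" using upper by (simp add: power4_eq_xxxx power2_eq_square mult_ac)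
    hence "ln (n m) \<le> ln (real m ^ 4)"
      using \<open>real m \<le> n m\<close> m by (subst ln_le_cancel_iff) auto
    hence "ln (n m) \<le> 4 * L" using m by (simp add: L_def ln_realpow)
    with lower upper ln1 show ?case by (simp add: L_def)
  qed
  have n_theta: "n \<in> \<Theta>(\<lambda>m. real m * ln (real m))"
  proof (rule bigthetaI)
    show "n \<in> O(\<lambda>m. real m * ln (real m))"
      by (rule bigoI[of _ 4]) (use bounds eventually_large_ln in eventually_elim, auto simp: n_def)
    show "n \<in> \<Omega>(\<lambda>m. real m * ln (real m))"
      by (rule landau_omega.bigI[of 1]) (simp, use bounds eventually_large_ln in eventually_elim, auto simp: n_def)
  qed
  have ln_theta: "(\<lambda>m. ln (n m)) \<in> \<Theta>(\<lambda>m. ln (real m))"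
  proof (rule bigthetaI)
    show "(\<lambda>m. ln (n m)) \<in> O(\<lambda>m. ln (real m))"
      by (rule bigoI[of _ 4]) (use bounds eventually_large_ln in eventually_elim, auto)
    show "(\<lambda>m. ln (n m)) \<in> \<Omega>(\<lambda>m. ln (real m))"
      by (rule landau_omega.bigI[of 1]) (simp, use bounds eventually_large_ln in eventually_elim, auto)
  qed
  have "(\<lambda>m. ln (n m) ^ 3 / (n m)\<^sup>2) \<in> \<Theta>(\<lambda>m. ln (real m) ^ 3 / (real m * ln (real m))\<^sup>2)"
    by (intro bigtheta_divide bigtheta_power n_theta ln_theta)
  also have "(\<lambda>m. ln (real m) ^ 3 / (real m * ln (real m))\<^sup>2) \<in> \<Theta>(\<lambda>m. ln (real m) / (real m)\<^sup>2)"
    by real_asymp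
  finally show ?thesis unfolding n_def .
qed

theorem theorem6:
  fixes M :: "nat \<Rightarrow> 'a measure" and X :: "nat \<Rightarrow> 'a \<Rightarrow> real"
  assumes "\<And>m. m \<ge> 2 \<Longrightarrow> prob_space (M m)"
    and "\<And>m. m \<ge> 2 \<Longrightarrow> distributed (M m) lborel (X m) (\<lambda>t. ennreal (pf_cme m t))"
  shows "(\<forall>m\<ge>2. matrix_exponential (pf_cme m)
            \<and> min_me_order (pf_cme m) = 2 * pf_power m * (m - 1) + 1)
    \<and> (\<lambda>m. prob_space.variance (M m) (X m)) \<in> \<Theta>(\<lambda>m. ln (real m) / (real m)\<^sup>2)
    \<and> (\<lambda>m. prob_space.expectation (M m) (X m) - 1) \<in> O(\<lambda>m. ln (real m) / (real m)\<^sup>2)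
    \<and> (\<lambda>m. scv (M m) (X m)) \<in> \<Theta>(\<lambda>m. ln (real m) / (real m)\<^sup>2)
    \<and> (\<lambda>m. scv (M m) (X m)) \<in> \<Theta>(\<lambda>m. ln (real (min_me_order (pf_cme m))) ^ 3
                                        / (real (min_me_order (pf_cme m)))\<^sup>2)"
proof -
  let ?rate = "\<lambda>m. ln (real m) / (real m)\<^sup>2"
  \<comment> \<open>The normalized second moment about 1: it majorizes the variance and, up to the
    factor e, the offset of the mean.\<close>
  define G where "G m = periodic_weight.moment2 (pf_weight m) / periodic_weight.mass (pf_weight m)" for m
  define E where "E m = prob_space.expectation (M m) (X m)" for m
  define Var where "Var m = prob_space.variance (M m) (X m)" for m
  have stats: "Var m \<le> G m" "(periodic_weight.mass (pf_weight m))\<^sup>2 / 32 \<le> Var m"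
      "\<bar>E m - 1\<bar> \<le> exp 1 * G m" "0 \<le> G m" if m: "m \<ge> 2" for m
  proof -
    interpret W: periodic_weight "pf_weight m" "pf_period m" by (rule periodic_weight_pf[OF m])
    have X: "distributed (M m) lborel (X m) (\<lambda>t. ennreal (W.weight_density t))"
      using assms(2)[OF m] by (simp only: pf_cme_eq_weight_density[OF m])
    note * = assms(1)[OF m] X pf_mass_pos[OF m]
    show "Var m \<le> G m" unfolding Var_def G_def by (rule W.variance_le[OF *])
    show "(periodic_weight.mass (pf_weight m))\<^sup>2 / 32 \<le> Var m"
      unfolding Var_def by (rule W.variance_ge[OF *])
    show "\<bar>E m - 1\<bar> \<le> exp 1 * G m" unfolding E_def G_def by (rule W.expectation_bound[OF *])
    show "0 \<le> G m" unfolding G_def by (simp add: W.moment2_nonneg W.mass_nonneg)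
  qed
  have G: "G \<in> O(?rate)"
  proof (rule landau_o.big_trans[OF _ pf_moment2_ratio_asymp], rule bigoI[of _ 1])
    show "\<forall>\<^sub>F m in sequentially. norm (G m) \<le> 1 * norm (2 * (2 * pi / (real m / sqrt (32 * ln (real m))) ^ 3
          + (3 * ln (real m)) ^ 3 * (3 * ln (real m) / (2 * real m)) ^ 6)
        / (sqrt (ln (real m)) / (144 * real m)) + 36 * ln (real m) / (real m)\<^sup>2)"
      using eventually_large_ln
    proof eventually_elim
      case (elim m)
      thus ?case using pf_moment2_ratio_le[of m] stats(4)[of m] unfolding G_def by simp
    qed
  qed
  have Var_O: "Var \<in> O(?rate)"
  proof (rule landau_o.big_trans[OF _ G], rule bigoI[of _ 1])
    show "\<forall>\<^sub>F m in sequentially. norm (Var m) \<le> 1 * norm (G m)"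
      using eventually_ge_at_top[of 2]
    proof eventually_elim
      case (elim m)
      thus ?case using stats(1,2,4)[OF elim] by (smt (verit) real_norm_def zero_le_power2 divide_nonneg_pos)
    qed
  qed
  have Var_Omega: "Var \<in> \<Omega>(?rate)"
  proof (rule landau_omega.bigI[of "1 / (144\<^sup>2 * 32)"])
    show "\<forall>\<^sub>F m in sequentially. norm (Var m) \<ge> 1 / (144\<^sup>2 * 32) * norm (?rate m)"
      using eventually_large_ln
    proof eventually_elim
      case (elim m)
      hence m: "m \<ge> 2" and L: "ln (real m) \<ge> 4" by auto
      have "(sqrt (ln (real m)) / (144 * real m))\<^sup>2 \<le> (periodic_weight.mass (pf_weight m))\<^sup>2"
        using pf_mass_ge[OF m L] L by (intro power_mono) auto
      moreover have "(sqrt (ln (real m)) / (144 * real m))\<^sup>2 = ?rate m / 144\<^sup>2"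
        using L by (simp add: power_divide power_mult_distrib)
      ultimately have "?rate m / 144\<^sup>2 / 32 \<le> (periodic_weight.mass (pf_weight m))\<^sup>2 / 32"
        by simp
      also note stats(2)[OF m]
      finally have "?rate m / 144\<^sup>2 / 32 \<le> Var m" .
      thus ?case using L by simp
    qed
  qed simp
  have Var_Theta: "Var \<in> \<Theta>(?rate)" using Var_O Var_Omega by (rule bigthetaI)
  have E_O: "(\<lambda>m. E m - 1) \<in> O(?rate)"
  proof (rule landau_o.big_trans[OF _ G], rule bigoI[of _ "exp 1"])
    show "\<forall>\<^sub>F m in sequentially. norm (E m - 1) \<le> exp 1 * norm (G m)"
      using eventually_ge_at_top[of 2] by eventually_elim (use stats(3,4) in simp)
  qed
  \<comment> \<open>The mean tends to 1, so dividing by its square preserves the order of the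
    variance.\<close>
  have "?rate \<in> o(\<lambda>_. 1)" by real_asymp
  with E_O have "(\<lambda>m. E m - 1) \<in> o(\<lambda>_. 1)" by (rule landau_o.big_small_trans)
  hence "(\<lambda>m. E m - 1) \<longlonglongrightarrow> 0" by (auto dest: smalloD_tendsto)
  hence "E \<longlonglongrightarrow> 1" by (simp add: LIM_zero_iff)
  hence "E \<in> \<Theta>(\<lambda>_. 1)" by (intro bigthetaI_tendsto[of 1]) simp_all
  hence "(\<lambda>m. Var m / (E m)\<^sup>2) \<in> \<Theta>(\<lambda>m. ?rate m / 1\<^sup>2)"
    by (intro bigtheta_divide bigtheta_power Var_Theta)
  hence scv: "(\<lambda>m. scv (M m) (X m)) \<in> \<Theta>(?rate)"
    by (simp add: scv_def Var_def E_def)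
  \<comment> \<open>The order formula is stated for \<open>m \<ge> 2\<close>, hence an eventual
    equality.\<close>
  have "\<forall>\<^sub>F m in sequentially. ln (real (min_me_order (pf_cme m))) ^ 3 / (real (min_me_order (pf_cme m)))\<^sup>2
      = ln (real (2 * pf_power m * (m - 1) + 1)) ^ 3 / (real (2 * pf_power m * (m - 1) + 1))\<^sup>2"
    using eventually_ge_at_top[of 2] by eventually_elim (simp only: pf_cme_order(2))
  hence "(\<lambda>m. ln (real (min_me_order (pf_cme m))) ^ 3 / (real (min_me_order (pf_cme m)))\<^sup>2) \<in> \<Theta>(?rate)"
    using pf_order_asymp by (subst landau_theta.in_cong)
  hence "?rate \<in> \<Theta>(\<lambda>m. ln (real (min_me_order (pf_cme m))) ^ 3 / (real (min_me_order (pf_cme m)))\<^sup>2)"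
    by (subst (asm) bigtheta_sym)
  from landau_theta.trans[OF scv this]
  have "(\<lambda>m. scv (M m) (X m)) \<in> \<Theta>(\<lambda>m. ln (real (min_me_order (pf_cme m))) ^ 3
                                        / (real (min_me_order (pf_cme m)))\<^sup>2)" .
  thus ?thesis
    using pf_cme_order Var_Theta E_O scv unfolding Var_def[abs_def] E_def by blast
qed

end
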